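(* Let $G$ be a finite group of order $k$ and let $\mathcal{M}\in M_{nk}(\mathbb{C})$ be a $G$-block circulant matrix (with blocks of size $n$). Let $M\in M_n(\mathbb{C}G)$ be the element associated with $\mathcal{M}$. Then there exists a permutation matrix $P$ such that $P^{-1}\mathcal{M}P=\widehat{M}(\lambda_G)$, where $\widehat{M}(\lambda_G)$ is the Fourier transform of $M$ at the left regular representation $\lambda_G$. Moreover, $$\sigma(\mathcal{M})=\bigsqcup_{\pi\ \text{irreducible}}\deg(\pi)\,\sigma(\widehat{M}(\pi)),$$ that is, the spectrum of $\mathcal{M}$ is the multiset union, over $\pi$ in a complete system of irreducible representations of $G$, of $\deg(\pi)$ copies of the spectrum of $\widehat{M}(\pi)$.
   Context: Fix an order $G=\{g_1,g_2,\dots,g_k\}$ with $g_1=1_G$. A matrix $\mathcal{M}\in M_{nk}(\mathbb{C})$, regarded as a $k\times k$ block matrix with blocks $\mathcal{M}_{r,p}\in M_n(\mathbb{C})$, is $G$-block circulant if $\mathcal{M}_{r,p}=\mathcal{M}_{r',p'}$ whenever $g_rg_p^{-1}=g_{r'}g_{p'}^{-1}$. $M_n(\mathbb{C}G)$ is the algebra of $n\times n$ matrices over the group algebra $\mathbb{C}G$; for $F\in M_n(\mathbb{C}G)$ and $x\in G$, $F(x)\in M_n(\mathbb{C})$ is the matrix whose $(i,j)$ entry is the coefficient of $x$ in $F_{i,j}$, and this identifies $M_n(\mathbb{C}G)$ with the functions $G\to M_n(\mathbb{C})$. The element $M\in M_n(\mathbb{C}G)$ associated with $\mathcal{M}$ is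 defined by $M(g_r)=\mathcal{M}_{r,1}$ for $r=1,\dots,k$. The Fourier transform of $F\in M_n(\mathbb{C}G)$ at a representation $\pi\colon G\to GL_m(\mathbb{C})$ (with $\deg(\pi)=m$) is $\widehat{F}(\pi)=\sum_{x\in G}F(x)\otimes\pi(x)\in M_{nm}(\mathbb{C})$, where $\otimes$ is the Kronecker product, $(B\otimes C)_{m(i-1)+r,\,m(j-1)+p}=B_{i,j}C_{r,p}$. The left regular representation $\lambda_G$ acts on $\mathbb{C}G$ by left multiplication; in the basis $g_1,\dots,g_k$, $\lambda_G(g)_{r,p}=1$ if $g=g_rg_p^{-1}$ and $0$ otherwise. A complete system of irreducible representations of $G$ is a list of pairwise inequivalent irreducible complex representations containing one from each equivalence class. $\sigma(\cdot)$ is the spectrum of a complex matrix, with eigenvalues counted with algebraic multiplicity. *)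

theory Defs
  imports
    "HOL-Algebra.Coset"
    "HOL-Combinatorics.Permutations"
    "HOL-Library.Multiset"
    "HOL-Computational_Algebra.Polynomial"
    "Jordan_Normal_Form.Matrix"
    "Jordan_Normal_Form.VS_Connect"
    "Jordan_Normal_Form.Char_Poly"
begin

text \<open>Block rows, block columns and all matrix entries are indexed from 0.\<close>

definition block :: "nat \<Rightarrow> complex mat \<Rightarrow> nat \<Rightarrow> nat \<Rightarrow> complex mat" where
  "block n A r p = mat n n (\<lambda>(i, j). A $$ (r * n + i, p * n + j))"

definition block_circulant ::
  "('g, 'b) monoid_scheme \<Rightarrow> nat \<Rightarrow> (nat \<Rightarrow> 'g) \<Rightarrow> nat \<Rightarrow> complex mat \<Rightarrow> bool" where
  "block_circulant G k g n A \<longleftrightarrow>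
     A \<in> carrier_mat (n * k) (n * k) \<and>
     (\<forall>r<k. \<forall>p<k. \<forall>r'<k. \<forall>p'<k.
        g r \<otimes>\<^bsub>G\<^esub> inv\<^bsub>G\<^esub> g p = g r' \<otimes>\<^bsub>G\<^esub> inv\<^bsub>G\<^esub> g p' \<longrightarrow>
        block n A r p = block n A r' p')"

text \<open>
  Elements of the group algebra are coefficient functions that vanish outside the carrier.
  For a finite group no further support condition is needed.
\<close>

definition group_algebra :: "('g, 'b) monoid_scheme \<Rightarrow> ('g \<Rightarrow> complex) set" where
  "group_algebra G = {a. \<forall>x. x \<notin> carrier G \<longrightarrow> a x = 0}"

definition mat_group_algebra :: "('g, 'b) monoid_scheme \<Rightarrow> nat \<Rightarrow> ('g \<Rightarrow> complex) mat set" where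
  "mat_group_algebra G n = {F \<in> carrier_mat n n. elements_mat F \<subseteq> group_algebra G}"

definition coeff_mat :: "('g \<Rightarrow> complex) mat \<Rightarrow> 'g \<Rightarrow> complex mat" where
  "coeff_mat F x = map_mat (\<lambda>a. a x) F"

definition associated ::
  "('g, 'b) monoid_scheme \<Rightarrow> nat \<Rightarrow> (nat \<Rightarrow> 'g) \<Rightarrow> nat \<Rightarrow> complex mat \<Rightarrow> ('g \<Rightarrow> complex) mat \<Rightarrow> bool"
where
  "associated G k g n A M \<longleftrightarrow>
     M \<in> mat_group_algebra G n \<and> (\<forall>r<k. coeff_mat M (g r) = block n A r 0)"

definition kronecker :: "complex mat \<Rightarrow> complex mat \<Rightarrow> complex mat" where
  "kronecker B C =
     mat (dim_row B * dim_row C) (dim_col B * dim_col C)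
       (\<lambda>(i, j). B $$ (i div dim_row C, j div dim_col C) * C $$ (i mod dim_row C, j mod dim_col C))"

definition GL :: "nat \<Rightarrow> complex mat monoid" where
  "GL m = units_of (ring_mat TYPE(complex) m ())"

definition representation :: "('g, 'b) monoid_scheme \<Rightarrow> nat \<Rightarrow> ('g \<Rightarrow> complex mat) \<Rightarrow> bool" where
  "representation G m \<pi> \<longleftrightarrow> \<pi> \<in> hom G (GL m)"

definition irreducible_rep :: "('g, 'b) monoid_scheme \<Rightarrow> nat \<Rightarrow> ('g \<Rightarrow> complex mat) \<Rightarrow> bool" where
  "irreducible_rep G m \<pi> \<longleftrightarrow>
     representation G m \<pi> \<and> m > 0 \<and>
     (\<forall>W. VectorSpace.subspace class_ring W (module_vec TYPE(complex) m) \<and>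
          (\<forall>x\<in>carrier G. \<forall>w\<in>W. \<pi> x *\<^sub>v w \<in> W) \<longrightarrow>
          W = {0\<^sub>v m} \<or> W = carrier_vec m)"

definition equivalent_rep ::
  "('g, 'b) monoid_scheme \<Rightarrow> nat \<times> ('g \<Rightarrow> complex mat) \<Rightarrow> nat \<times> ('g \<Rightarrow> complex mat) \<Rightarrow> bool" where
  "equivalent_rep G \<alpha> \<beta> \<longleftrightarrow>
     fst \<alpha> = fst \<beta> \<and>
     (\<exists>T\<in>carrier (GL (fst \<alpha>)). \<forall>x\<in>carrier G. T * snd \<alpha> x = snd \<beta> x * T)"

text \<open>A representation is listed together with its degree.\<close>

definition complete_system ::
  "('g, 'b) monoid_scheme \<Rightarrow> (nat \<times> ('g \<Rightarrow> complex mat)) list \<Rightarrow> bool" where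
  "complete_system G ps \<longleftrightarrow>
     (\<forall>(m, \<pi>)\<in>set ps. irreducible_rep G m \<pi>) \<and>
     (\<forall>i<length ps. \<forall>j<length ps. i \<noteq> j \<longrightarrow> \<not> equivalent_rep G (ps ! i) (ps ! j)) \<and>
     (\<forall>m \<pi>. irreducible_rep G m \<pi> \<longrightarrow> (\<exists>\<rho>\<in>set ps. equivalent_rep G (m, \<pi>) \<rho>))"

definition regular_rep ::
  "('g, 'b) monoid_scheme \<Rightarrow> nat \<Rightarrow> (nat \<Rightarrow> 'g) \<Rightarrow> 'g \<Rightarrow> complex mat" where
  "regular_rep G k g x =
     mat k k (\<lambda>(r, p). if x = g r \<otimes>\<^bsub>G\<^esub> inv\<^bsub>G\<^esub> g p then 1 else 0)"

definition fourier ::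
  "('g, 'b) monoid_scheme \<Rightarrow> nat \<Rightarrow> ('g \<Rightarrow> complex) mat \<Rightarrow> nat \<Rightarrow> ('g \<Rightarrow> complex mat) \<Rightarrow> complex mat"
where
  "fourier G n F m \<pi> =
     (\<Oplus>\<^bsub>module_mat TYPE(complex) (n * m) (n * m)\<^esub>x\<in>carrier G. kronecker (coeff_mat F x) (\<pi> x))"

definition permutation_matrix :: "nat \<Rightarrow> complex mat \<Rightarrow> bool" where
  "permutation_matrix N P \<longleftrightarrow>
     (\<exists>\<sigma>. \<sigma> permutes {..<N} \<and> P = mat N N (\<lambda>(i, j). if i = \<sigma> j then 1 else 0))"

text \<open>Eigenvalues counted with algebraic multiplicity.\<close>

definition eigenvalue_mset :: "complex mat \<Rightarrow> complex multiset" where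
  "eigenvalue_mset A = proots (char_poly A)"

end

theory Submission
  imports Defs "Jordan_Normal_Form.Spectral_Radius"
begin

text \<open>
  Exchanging the two Kronecker factors is conjugation by a permutation matrix, and the block
  circulant matrix is the Fourier transform at the regular representation with the factors exchanged.
  Along an invariant subspace the exchanged transform becomes block triangular, so its characteristic
  polynomial is the product over the composition factors of the representation. By Schur orthogonality
  of characters, the regular representation, with character k at the identity and 0 elsewhere, has
  each irreducible representation as a composition factor as often as its degree.
\<close>

section \<open>Matrices\<close>

text \<open>The order of the factors decides which structure is visible. In
  \<open>kronecker (coeff_mat F x) (\<pi> x)\<close> the zeros that an invariant subspace forces on
  \<open>\<pi> x\<close> are scattered over all n * n blocks; in
  \<open>kronecker (\<pi> x) (coeff_mat F x)\<close> they fill one rectangle in the lower left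
  corner, the same for every x, and so survive the summation. A change of basis acts on the outer
  factor alone, as S tensored with the identity, and leaves the coefficients untouched.
  Multiplicities cannot be read off the characteristic polynomial for one given M, since transforms
  at different representations may share eigenvalues. Hence one list of constituents is produced
  that serves all coefficient families and also the traces of the representation; the traces alone
  then fix how often each irreducible occurs.\<close>

lemma kronecker_carrier [simp]:
  assumes "B \<in> carrier_mat n n" "C \<in> carrier_mat m m"
  shows "kronecker B C \<in> carrier_mat (n * m) (n * m)"
  using assms by (auto simp: kronecker_def)

lemma kronecker_index:
  assumes "B \<in> carrier_mat n n" "C \<in> carrier_mat m m" "a < n * m" "b < n * m"
  shows "kronecker B C $$ (a, b) = B $$ (a div m, b div m) * C $$ (a mod m, b mod m)"
  using assms by (auto simp: kronecker_def)

lemma mult_add_less_mult: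
  fixes i j p q :: nat
  assumes "i < p" "j < q"
  shows "i * q + j < p * q"
proof -
  have "i * q + j < Suc i * q" using assms(2) by simp
  also have "\<dots> \<le> p * q" using assms(1) by (intro mult_le_mono) auto
  finally show ?thesis .
qed

lemma sum_lessThan_mult:
  fixes f :: "nat \<Rightarrow> nat \<Rightarrow> 'a::comm_monoid_add"
  shows "(\<Sum>c<p * q. f (c div q) (c mod q)) = (\<Sum>i<p. \<Sum>j<q. f i j)"
proof (cases "q = 0")
  case False
  have "(\<Sum>c<p * q. f (c div q) (c mod q)) = (\<Sum>(i, j)\<in>{..<p} \<times> {..<q}. f i j)"
    by (rule sum.reindex_bij_witness[of _ "\<lambda>(i, j). i * q + j" "\<lambda>c. (c div q, c mod q)"])
      (use False in \<open>auto simp: less_mult_imp_div_less mult_add_less_mult\<close>)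
  then show ?thesis by (simp add: sum.cartesian_product)
qed simp

text \<open>The mixed product rule: summing over c amounts to summing independently over its
  quotient and remainder by m, and the double sum factors.\<close>

lemma kronecker_mult:
  assumes B: "B \<in> carrier_mat n n" "B' \<in> carrier_mat n n"
    and C: "C \<in> carrier_mat m m" "C' \<in> carrier_mat m m"
  shows "kronecker B C * kronecker B' C' = kronecker (B * B') (C * C')"
proof (rule eq_matI)
  fix a b
  assume "a < dim_row (kronecker (B * B') (C * C'))" "b < dim_col (kronecker (B * B') (C * C'))"
  then have ab: "a < n * m" "b < n * m" using assms by (auto simp: kronecker_def)
  then have m: "m > 0" by (cases m) auto
  have d: "a div m < n" "b div m < n" "a mod m < m" "b mod m < m"
    using ab m by (auto simp: less_mult_imp_div_less)
  have "(kronecker B C * kronecker B' C') $$ (a, b)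
      = (\<Sum>c<n * m. kronecker B C $$ (a, c) * kronecker B' C' $$ (c, b))"
    using ab assms by (auto simp: scalar_prod_def kronecker_def atLeast0LessThan)
  also have "\<dots> = (\<Sum>c<n * m. (B $$ (a div m, c div m) * B' $$ (c div m, b div m))
                     * (C $$ (a mod m, c mod m) * C' $$ (c mod m, b mod m)))"
    by (rule sum.cong) (use ab in \<open>auto simp: kronecker_index[OF B(1) C(1)] kronecker_index[OF B(2) C(2)]\<close>)
  also have "\<dots> = (\<Sum>i<n. \<Sum>j<m. (B $$ (a div m, i) * B' $$ (i, b div m))
                     * (C $$ (a mod m, j) * C' $$ (j, b mod m)))"
    by (rule sum_lessThan_mult)
  also have "\<dots> = (B * B') $$ (a div m, b div m) * (C * C') $$ (a mod m, b mod m)"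
    using d assms by (simp add: scalar_prod_def atLeast0LessThan sum_product)
  also have "\<dots> = kronecker (B * B') (C * C') $$ (a, b)"
    by (rule kronecker_index[symmetric, of _ n _ m]) (use assms ab in auto)
  finally show "(kronecker B C * kronecker B' C') $$ (a, b) = kronecker (B * B') (C * C') $$ (a, b)" .
qed (use assms in \<open>auto simp: kronecker_def\<close>)

lemma kronecker_one: "kronecker (1\<^sub>m n) (1\<^sub>m m) = 1\<^sub>m (n * m)"
proof (rule eq_matI)
  fix a b assume "a < dim_row (1\<^sub>m (n * m) :: complex mat)" "b < dim_col (1\<^sub>m (n * m) :: complex mat)"
  then have ab: "a < n * m" "b < n * m" by auto
  then have m: "m > 0" by (cases m) auto
  have d: "a div m < n" "b div m < n" "a mod m < m" "b mod m < m"
    using ab m by (auto simp: less_mult_imp_div_less)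
  have "a = b \<longleftrightarrow> a div m = b div m \<and> a mod m = b mod m"
    by (metis div_mult_mod_eq)
  then show "kronecker (1\<^sub>m n) (1\<^sub>m m) $$ (a, b) = 1\<^sub>m (n * m) $$ (a, b)"
    using ab d by (auto simp: kronecker_def)
qed (auto simp: kronecker_def)

text \<open>An entrywise counterpart of \<open>finsum\<close> over \<open>module_mat\<close>: its
  size and its entries are available without carrier conditions on the summands.\<close>

definition mat_sum :: "nat \<Rightarrow> ('x \<Rightarrow> complex mat) \<Rightarrow> 'x set \<Rightarrow> complex mat" where
  "mat_sum N f X = mat N N (\<lambda>(i, j). \<Sum>x\<in>X. f x $$ (i, j))"

lemma mat_sum_carrier [simp]: "mat_sum N f X \<in> carrier_mat N N"
  and mat_sum_dim [simp]: "dim_row (mat_sum N f X) = N" "dim_col (mat_sum N f X) = N"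
  and mat_sum_index [simp]:
    "i < N \<Longrightarrow> j < N \<Longrightarrow> mat_sum N f X $$ (i, j) = (\<Sum>x\<in>X. f x $$ (i, j))"
  by (auto simp: mat_sum_def)

lemma mat_sum_cong: "(\<And>x. x \<in> X \<Longrightarrow> f x = h x) \<Longrightarrow> mat_sum N f X = mat_sum N h X"
  by (auto simp: mat_sum_def intro!: cong_mat sum.cong)

lemma finsum_module_mat:
  assumes "finite X" "\<And>x. x \<in> X \<Longrightarrow> f x \<in> carrier_mat N N"
  shows "finsum (module_mat TYPE(complex) N N) f X = mat_sum N f X"
proof -
  interpret vectorspace class_ring "module_mat TYPE(complex) N N" by (rule matrix_vs)
  from assms show ?thesis
  proof (induction X rule: finite_induct)
    case empty
    show ?case by (auto simp: mat_sum_def module_mat_simps intro!: eq_matI)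
  next
    case (insert x X)
    have "finsum (module_mat TYPE(complex) N N) f (insert x X) = f x + mat_sum N f X"
      using insert by (subst finsum_insert) (auto simp: module_mat_simps)
    also have "\<dots> = mat_sum N f (insert x X)"
      using insert by (intro eq_matI) auto
    finally show ?case .
  qed
qed

lemma mult_mat_sum:
  assumes "B \<in> carrier_mat N N" "\<And>x. x \<in> X \<Longrightarrow> f x \<in> carrier_mat N N"
  shows "B * mat_sum N f X = mat_sum N (\<lambda>x. B * f x) X"
proof (rule eq_matI)
  fix i j assume "i < dim_row (mat_sum N (\<lambda>x. B * f x) X)" "j < dim_col (mat_sum N (\<lambda>x. B * f x) X)"
  then have ij: "i < N" "j < N" by auto
  have "(B * mat_sum N f X) $$ (i, j) = (\<Sum>c<N. \<Sum>x\<in>X. B $$ (i, c) * f x $$ (c, j))"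
    using ij assms(1) by (simp add: scalar_prod_def atLeast0LessThan sum_distrib_left)
  also have "\<dots> = (\<Sum>x\<in>X. \<Sum>c<N. B $$ (i, c) * f x $$ (c, j))" by (rule sum.swap)
  also have "\<dots> = (\<Sum>x\<in>X. (B * f x) $$ (i, j))"
  proof (rule sum.cong)
    fix x assume "x \<in> X"
    from assms(2)[OF this] show "(\<Sum>c<N. B $$ (i, c) * f x $$ (c, j)) = (B * f x) $$ (i, j)"
      using ij assms(1) by (simp add: scalar_prod_def atLeast0LessThan)
  qed simp
  finally show "(B * mat_sum N f X) $$ (i, j) = mat_sum N (\<lambda>x. B * f x) X $$ (i, j)" using ij by simp
qed (use assms in auto)

lemma mat_sum_mult:
  assumes "B \<in> carrier_mat N N" "\<And>x. x \<in> X \<Longrightarrow> f x \<in> carrier_mat N N"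
  shows "mat_sum N f X * B = mat_sum N (\<lambda>x. f x * B) X"
proof (rule eq_matI)
  fix i j assume "i < dim_row (mat_sum N (\<lambda>x. f x * B) X)" "j < dim_col (mat_sum N (\<lambda>x. f x * B) X)"
  then have ij: "i < N" "j < N" by auto
  have "(mat_sum N f X * B) $$ (i, j) = (\<Sum>c<N. \<Sum>x\<in>X. f x $$ (i, c) * B $$ (c, j))"
    using ij assms(1) by (simp add: scalar_prod_def atLeast0LessThan sum_distrib_right)
  also have "\<dots> = (\<Sum>x\<in>X. \<Sum>c<N. f x $$ (i, c) * B $$ (c, j))" by (rule sum.swap)
  also have "\<dots> = (\<Sum>x\<in>X. (f x * B) $$ (i, j))"
  proof (rule sum.cong)
    fix x assume "x \<in> X"
    from assms(2)[OF this] show "(\<Sum>c<N. f x $$ (i, c) * B $$ (c, j)) = (f x * B) $$ (i, j)"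
      using ij assms(1) by (simp add: scalar_prod_def atLeast0LessThan)
  qed simp
  finally show "(mat_sum N f X * B) $$ (i, j) = mat_sum N (\<lambda>x. f x * B) X $$ (i, j)" using ij by simp
qed (use assms in auto)

section \<open>Traces\<close>

definition mat_trace :: "complex mat \<Rightarrow> complex" where
  "mat_trace A = (\<Sum>i<dim_row A. A $$ (i, i))"

text \<open>Rectangular factors are allowed so that comparing the traces of two identity matrices
  can show that an invertible intertwiner is square.\<close>

lemma mat_trace_comm:
  assumes "A \<in> carrier_mat n m" "B \<in> carrier_mat m n"
  shows "mat_trace (A * B) = mat_trace (B * A)"
proof -
  have "mat_trace (A * B) = (\<Sum>i<n. \<Sum>j<m. A $$ (i, j) * B $$ (j, i))"
    using assms by (simp add: mat_trace_def scalar_prod_def atLeast0LessThan)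
  also have "\<dots> = (\<Sum>j<m. \<Sum>i<n. A $$ (i, j) * B $$ (j, i))" by (rule sum.swap)
  also have "\<dots> = mat_trace (B * A)"
    using assms by (simp add: mat_trace_def scalar_prod_def atLeast0LessThan mult.commute)
  finally show ?thesis .
qed

lemma mat_trace_similar:
  assumes "similar_mat A B"
  shows "mat_trace A = mat_trace B"
proof -
  from similar_matD[OF assms] obtain n P Q where c: "A \<in> carrier_mat n n" "B \<in> carrier_mat n n"
    "P \<in> carrier_mat n n" "Q \<in> carrier_mat n n" and 1: "Q * P = 1\<^sub>m n" and A: "A = P * B * Q" by auto
  have "mat_trace A = mat_trace (Q * (P * B))"
    unfolding A by (rule mat_trace_comm) (use c in auto)
  also have "Q * (P * B) = B" using c 1 by (metis assoc_mult_mat left_mult_one_mat)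
  finally show ?thesis .
qed

section \<open>Invertible matrices and index permutations\<close>

lemma GL_iff:
  "T \<in> carrier (GL m) \<longleftrightarrow> T \<in> carrier_mat m m \<and> (\<exists>S\<in>carrier_mat m m. S * T = 1\<^sub>m m \<and> T * S = 1\<^sub>m m)"
  unfolding GL_def units_of_def Units_def by (auto simp: ring_mat_simps)

lemma GL_simps [simp]: "monoid.mult (GL m) = (*)" "one (GL m) = 1\<^sub>m m"
  unfolding GL_def units_of_def by (auto simp: ring_mat_simps)

lemma group_GL: "group (GL m)"
  unfolding GL_def by (intro monoid.units_group ring.is_monoid ring_mat)

lemma GL_inv:
  assumes "S \<in> carrier_mat m m" "T \<in> carrier_mat m m" "S * T = 1\<^sub>m m" "T * S = 1\<^sub>m m"
  shows "inv\<^bsub>GL m\<^esub> T = S"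
  by (rule group.inv_equality[OF group_GL]) (use assms in \<open>auto simp: GL_iff\<close>)

text \<open>Column j of P is the unit vector at \<open>\<sigma> j\<close>, so right multiplication
  by P brings column \<open>\<sigma> j\<close> to place j. The transpose Q, which is the inverse of
  P, does the same to rows from the left.\<close>

lemma permutation_conjugate:
  assumes \<sigma>: "\<sigma> permutes {..<N}" and A: "A \<in> carrier_mat N N"
  defines "P \<equiv> mat N N (\<lambda>(i, j). if i = \<sigma> j then 1 else 0)"
  shows "inv\<^bsub>GL N\<^esub> P * A * P = mat N N (\<lambda>(i, j). A $$ (\<sigma> i, \<sigma> j))" (is ?eq)
    and "similar_mat (mat N N (\<lambda>(i, j). A $$ (\<sigma> i, \<sigma> j))) A" (is ?sim)
proof -
  define Q :: "complex mat" where "Q = mat N N (\<lambda>(i, j). if j = \<sigma> i then 1 else 0)"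
  have c: "P \<in> carrier_mat N N" "Q \<in> carrier_mat N N" by (auto simp: P_def Q_def)
  have lt: "\<sigma> i < N" if "i < N" for i using permutes_in_image[OF \<sigma>, of i] that by auto
  have inj: "\<sigma> i = \<sigma> j \<longleftrightarrow> i = j" for i j using permutes_inj[OF \<sigma>] by (auto dest: injD)
  have QB: "(Q * B) $$ (i, j) = B $$ (\<sigma> i, j)" if "B \<in> carrier_mat N N" "i < N" "j < N" for B i j
  proof -
    have "(Q * B) $$ (i, j) = (\<Sum>c<N. (if c = \<sigma> i then 1 else 0) * B $$ (c, j))"
      using that c by (simp add: scalar_prod_def atLeast0LessThan Q_def)
    also have "\<dots> = (\<Sum>c<N. if c = \<sigma> i then B $$ (c, j) else 0)" by (rule sum.cong) auto
    finally show ?thesis using lt that by simp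
  qed
  have BP: "(B * P) $$ (i, j) = B $$ (i, \<sigma> j)" if "B \<in> carrier_mat N N" "i < N" "j < N" for B i j
  proof -
    have "(B * P) $$ (i, j) = (\<Sum>c<N. B $$ (i, c) * (if c = \<sigma> j then 1 else 0))"
      using that c by (simp add: scalar_prod_def atLeast0LessThan P_def)
    also have "\<dots> = (\<Sum>c<N. if c = \<sigma> j then B $$ (i, c) else 0)" by (rule sum.cong) auto
    finally show ?thesis using lt that by simp
  qed
  have QP: "Q * P = 1\<^sub>m N"
  proof (rule eq_matI)
    fix i j assume "i < dim_row (1\<^sub>m N :: complex mat)" "j < dim_col (1\<^sub>m N :: complex mat)"
    then have ij: "i < N" "j < N" by auto
    show "(Q * P) $$ (i, j) = 1\<^sub>m N $$ (i, j)"
      unfolding QB[OF c(1) ij] using ij lt by (auto simp: P_def inj)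
  qed (use c in auto)
  have PQ: "P * Q = 1\<^sub>m N" by (rule mat_mult_left_right_inverse[OF c(2,1) QP])
  have conj: "Q * A * P = mat N N (\<lambda>(i, j). A $$ (\<sigma> i, \<sigma> j))"
  proof (rule eq_matI)
    fix i j
    assume "i < dim_row (mat N N (\<lambda>(i, j). A $$ (\<sigma> i, \<sigma> j)))"
      "j < dim_col (mat N N (\<lambda>(i, j). A $$ (\<sigma> i, \<sigma> j)))"
    then have ij: "i < N" "j < N" by auto
    have "Q * A \<in> carrier_mat N N" using c A by auto
    then show "(Q * A * P) $$ (i, j) = mat N N (\<lambda>(i, j). A $$ (\<sigma> i, \<sigma> j)) $$ (i, j)"
      using ij lt by (simp add: BP QB[OF A] del: index_mult_mat(1))
  qed (use c in auto)
  show ?eq using GL_inv[OF c(2,1) QP PQ] conj by simp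
  show ?sim
    by (rule similar_matI[of _ _ Q P N]) (use c A PQ QP conj in auto)
qed

text \<open>Reads a as the position (a div p, a mod p) in an array with q rows and p columns and
  returns its place in the transposed array. Outside the array it is the identity, as
  \<open>permutes\<close> demands.\<close>

definition transpose_index :: "nat \<Rightarrow> nat \<Rightarrow> nat \<Rightarrow> nat" where
  "transpose_index p q a = (if a < p * q then (a mod p) * q + a div p else a)"

lemma transpose_index_less:
  fixes a p q :: nat
  assumes "a < p * q"
  shows "(a mod p) * q + a div p < p * q" "((a mod p) * q + a div p) div q = a mod p"
    "((a mod p) * q + a div p) mod q = a div p"
proof -
  have p: "p > 0" using assms by (cases p) auto
  have d: "a div p < q" "a mod p < p" using assms p by (auto simp: div_less_iff_less_mult mult.commute)
  show "(a mod p) * q + a div p < p * q"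
    using d by (intro mult_add_less_mult)
  show "((a mod p) * q + a div p) div q = a mod p" "((a mod p) * q + a div p) mod q = a div p"
    using d by auto
qed

text \<open>Transposing back, with p and q exchanged, is the inverse.\<close>

lemma transpose_index_permutes: "transpose_index p q permutes {..<p * q}"
proof (rule bij_imp_permutes)
  show "bij_betw (transpose_index p q) {..<p * q} {..<p * q}"
    by (rule bij_betwI[of _ _ _ "transpose_index q p"])
      (use transpose_index_less[of _ p q] transpose_index_less[of _ q p] in
        \<open>auto simp: transpose_index_def mult.commute[of q p]\<close>)
qed (auto simp: transpose_index_def)

text \<open>The two orders of the factors use the quotient and the remainder of an index in opposite
  roles, and transposing the index array exchanges exactly these.\<close>

lemma kronecker_swap:
  assumes "B \<in> carrier_mat n n" "C \<in> carrier_mat m m"  "a < n * m" "b < n * m"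
  shows "kronecker B C $$ (a, b) = kronecker C B $$ (transpose_index m n a, transpose_index m n b)"
  using assms transpose_index_less[of a m n] transpose_index_less[of b m n]
  by (simp add: kronecker_index transpose_index_def mult.commute[of m n])

section \<open>Subspaces and adapted coordinates\<close>

lemma subspace_iff:
  "VectorSpace.subspace class_ring W (module_vec TYPE(complex) m) \<longleftrightarrow>
     W \<subseteq> carrier_vec m \<and> 0\<^sub>v m \<in> W \<and> (\<forall>v\<in>W. \<forall>w\<in>W. v + w \<in> W) \<and> (\<forall>c. \<forall>v\<in>W. c \<cdot>\<^sub>v v \<in> W)"
  using vec_vs[of m, where 'a = complex] vec_module[of m, where 'a = complex]
  by (auto simp: VectorSpace.subspace_def submodule_def module_vec_simps)

lemma GL_of_det:
  assumes "A \<in> carrier_mat m m" "det A \<noteq> 0"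
  shows "A \<in> carrier (GL m)"
  using det_non_zero_imp_unit[OF assms] by (simp add: GL_def units_of_def)

text \<open>Steinitz exchange in coordinates: column d of the identity becomes c, and the displaced
  unit vector moves to column j, whose own one is dropped; for j = d only the replacement remains. A
  kernel vector v vanishes at d by row j, where c is nonzero, then at j by row d, then everywhere
  else.\<close>

lemma exchange_mat_det:
  fixes c :: "complex vec"
  assumes c: "c \<in> carrier_vec m" and dj: "d < m" "j < m" and cj: "c $ j \<noteq> 0"
  defines "E \<equiv> mat m m (\<lambda>(i, l). if l = d then c $ i else if l = j then (if i = d then 1 else 0)
                 else if i = l then 1 else 0)"
  shows "det E \<noteq> 0"
proof
  have E: "E \<in> carrier_mat m m" by (simp add: E_def)
  assume "det E = 0"
  with det_0_iff_vec_prod_zero[OF E] obtain v where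
    v: "v \<in> carrier_vec m" "v \<noteq> 0\<^sub>v m" and Ev: "E *\<^sub>v v = 0\<^sub>v m" by auto
  have eq: "c $ i * v $ d + (if j \<noteq> d \<and> i = d then v $ j else 0)
      + (if i \<noteq> d \<and> i \<noteq> j then v $ i else 0) = 0" if i: "i < m" for i
  proof -
    have "0 = (E *\<^sub>v v) $ i" using Ev i by simp
    also have "\<dots> = (\<Sum>l<m. (if l = d then c $ i else if l = j then (if i = d then 1 else 0)
                 else if i = l then 1 else 0) * v $ l)"
      using i v unfolding E_def by (simp add: scalar_prod_def atLeast0LessThan)
    \<comment> \<open>Each term is split into parts supported at l = d, l = j and l = i; the inner
      conditions prevent double counting when these indices coincide.\<close>
    also have "\<dots> = (\<Sum>l<m. (if l = d then c $ i * v $ d else 0)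
        + (if l = j then (if j \<noteq> d \<and> i = d then v $ j else 0) else 0)
        + (if l = i then (if i \<noteq> d \<and> i \<noteq> j then v $ i else 0) else 0))"
      by (rule sum.cong) auto
    also have "\<dots> = c $ i * v $ d + (if j \<noteq> d \<and> i = d then v $ j else 0)
      + (if i \<noteq> d \<and> i \<noteq> j then v $ i else 0)"
      using i dj by (simp add: sum.distrib)
    finally show ?thesis by simp
  qed
  have d0: "v $ d = 0" using eq[of j] dj cj by (auto split: if_splits)
  have j0: "v $ j = 0" using eq[of d] dj d0 by (auto split: if_splits)
  have "v $ i = 0" if "i < m" for i
    using eq[OF that] d0 j0 by (auto split: if_splits)
  then have "v = 0\<^sub>v m" using v by (intro eq_vecI) auto
  with v show False by simp
qed

lemma mult_unit_vec:
  fixes T :: "complex mat"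
  assumes "T \<in> carrier_mat n m" "l < m"
  shows "T *\<^sub>v unit_vec m l = col T l"
  using assms by (intro eq_vecI) (auto simp: scalar_prod_right_unit)

text \<open>A coordinate system with as many initial basis vectors in W as possible is adapted to W:
  otherwise one further basis vector could be exchanged for an element of W.\<close>

lemma adapted_basis:
  assumes W: "W \<subseteq> carrier_vec m"
  obtains T S :: "complex mat" and d where
    "T \<in> carrier_mat m m" "S \<in> carrier_mat m m" "S * T = 1\<^sub>m m" "T * S = 1\<^sub>m m" "d \<le> m"
    "\<And>l. l < d \<Longrightarrow> col T l \<in> W"
    "\<And>w i. w \<in> W \<Longrightarrow> d \<le> i \<Longrightarrow> i < m \<Longrightarrow> (S *\<^sub>v w) $ i = 0"
proof -
  define Q where "Q d \<longleftrightarrow> d \<le> m \<and> (\<exists>T\<in>carrier (GL m). \<forall>l<d. col T l \<in> W)" for d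
  have "Q 0" by (auto simp: Q_def GL_iff Bex_def intro!: exI[of _ "1\<^sub>m m"])
  moreover have "\<forall>d. Q d \<longrightarrow> d \<le> m" by (auto simp: Q_def)
  ultimately obtain d where d: "Q d" and max: "\<And>e. Q e \<Longrightarrow> e \<le> d"
    using Nat.ex_has_greatest_nat[of Q 0 m] by auto
  from d obtain T S where T: "T \<in> carrier_mat m m" "S \<in> carrier_mat m m" "S * T = 1\<^sub>m m" "T * S = 1\<^sub>m m"
    and dm: "d \<le> m" and col: "\<And>l. l < d \<Longrightarrow> col T l \<in> W" by (auto simp: Q_def GL_iff)
  have "(S *\<^sub>v w) $ j = 0" if w: "w \<in> W" and j: "d \<le> j" "j < m" for w j
  proof (rule ccontr)
    define c where "c = S *\<^sub>v w"
    assume "(S *\<^sub>v w) $ j \<noteq> 0"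
    then have cj: "c $ j \<noteq> 0" by (simp add: c_def)
    have wc: "w \<in> carrier_vec m" using w W by auto
    have c: "c \<in> carrier_vec m" using T wc by (simp add: c_def)
    have Tc: "T *\<^sub>v c = w" using T wc unfolding c_def
      by (metis assoc_mult_mat_vec one_mult_mat_vec)
    define E where "E = mat m m (\<lambda>(i, l). if l = d then c $ i else if l = j then (if i = d then 1 else 0)
                 else if i = l then 1 else 0)"
    have E: "E \<in> carrier_mat m m" by (simp add: E_def)
    have "E \<in> carrier (GL m)"
      using GL_of_det[OF E] exchange_mat_det[OF c _ j(2) cj, of d] j by (simp add: E_def)
    moreover have "T \<in> carrier (GL m)" using T by (auto simp: GL_iff)
    ultimately have "T \<otimes>\<^bsub>GL m\<^esub> E \<in> carrier (GL m)"
      by (intro monoid.m_closed group.is_monoid group_GL)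
    then have TE: "T * E \<in> carrier (GL m)" by simp
    \<comment> \<open>Because d \<le> j, multiplication by E leaves the first d columns of T alone;
      it turns column d into T applied to c, which is w. This contradicts the maximality of
      d.\<close>
    have "col (T * E) l \<in> W" if l: "l < Suc d" for l
    proof (cases "l = d")
      case True
      then have "col E l = c" using c j by (auto simp: E_def)
      then show ?thesis using Tc w T E l j by (simp del: col_mult)
    next
      case False
      then have "col E l = unit_vec m l" using c j l by (auto simp: E_def intro!: eq_vecI)
      moreover have "T *\<^sub>v unit_vec m l = col T l" using T l j by (intro mult_unit_vec) auto
      ultimately show ?thesis using col[of l] False T E l j by (simp del: col_mult)
    qed
    with TE j have "Q (Suc d)" by (auto simp: Q_def)
    with max show False by fastforce
  qed
  with T dm col show ?thesis by (intro that[of T S d])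
qed

text \<open>The product is the combination of the columns of T with the entries of v as
  coefficients; the induction lets in one entry of v at a time.\<close>

lemma mult_mat_vec_mem:
  fixes T :: "complex mat"
  assumes T: "T \<in> carrier_mat m m" and W: "VectorSpace.subspace class_ring W (module_vec TYPE(complex) m)"
    and col: "\<And>l. l < m \<Longrightarrow> col T l \<in> W"
    and v: "v \<in> carrier_vec m"
  shows "T *\<^sub>v v \<in> W"
proof -
  note W' = W[unfolded subspace_iff]
  have "T *\<^sub>v vec m (\<lambda>i. if i < e then v $ i else 0) \<in> W" if "e \<le> m" for e
    using that
  proof (induction e)
    case 0
    have "T *\<^sub>v vec m (\<lambda>i. if i < 0 then v $ i else 0) = 0\<^sub>v m"
      using T by (intro eq_vecI) (auto simp: scalar_prod_def)
    then show ?case using W' by simp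
  next
    case (Suc e)
    have "vec m (\<lambda>i. if i < Suc e then v $ i else 0)
        = vec m (\<lambda>i. if i < e then v $ i else 0) + v $ e \<cdot>\<^sub>v unit_vec m e"
      by (intro eq_vecI) (use Suc.prems in \<open>auto simp: unit_vec_def less_Suc_eq\<close>)
    moreover have "T *\<^sub>v (v $ e \<cdot>\<^sub>v unit_vec m e) = v $ e \<cdot>\<^sub>v col T e"
      using T Suc.prems mult_unit_vec[OF T, of e] by (simp add: mult_mat_vec[OF T])
    ultimately have "T *\<^sub>v vec m (\<lambda>i. if i < Suc e then v $ i else 0)
        = T *\<^sub>v vec m (\<lambda>i. if i < e then v $ i else 0) + v $ e \<cdot>\<^sub>v col T e"
      using T by (simp add: mult_add_distrib_mat_vec[OF T])
    then show ?case using Suc W' col by auto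
  qed
  from this[of m] have "T *\<^sub>v vec m (\<lambda>i. if i < m then v $ i else 0) \<in> W" by simp
  also have "vec m (\<lambda>i. if i < m then v $ i else 0) = v" using v by auto
  finally show ?thesis .
qed

section \<open>Composition series\<close>

context group
begin

lemma representationD:
  assumes "representation G m \<pi>"
  shows "x \<in> carrier G \<Longrightarrow> \<pi> x \<in> carrier_mat m m"
    and "x \<in> carrier G \<Longrightarrow> y \<in> carrier G \<Longrightarrow> \<pi> (x \<otimes> y) = \<pi> x * \<pi> y"
    and "\<pi> \<one> = 1\<^sub>m m"
proof -
  have h: "\<pi> \<in> hom G (GL m)" using assms by (simp add: representation_def)
  then show "x \<in> carrier G \<Longrightarrow> \<pi> x \<in> carrier_mat m m"
    using hom_in_carrier[OF h] by (auto simp: GL_iff)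
  show "x \<in> carrier G \<Longrightarrow> y \<in> carrier G \<Longrightarrow> \<pi> (x \<otimes> y) = \<pi> x * \<pi> y"
    using hom_mult[OF h] by simp
  show "\<pi> \<one> = 1\<^sub>m m" using hom_one[OF h is_group group_GL] by simp
qed

text \<open>Multiplicativity already gives invertible values: \<open>\<pi> (inv x)\<close> is the
  inverse of \<open>\<pi> x\<close>.\<close>

lemma representationI:
  assumes c: "\<And>x. x \<in> carrier G \<Longrightarrow> \<pi> x \<in> carrier_mat m m"
    and m: "\<And>x y. x \<in> carrier G \<Longrightarrow> y \<in> carrier G \<Longrightarrow> \<pi> (x \<otimes> y) = \<pi> x * \<pi> y"
    and 1: "\<pi> \<one> = 1\<^sub>m m"
  shows "representation G m \<pi>"
  unfolding representation_def
proof (rule homI)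
  fix x assume x: "x \<in> carrier G"
  have "\<pi> (inv x) * \<pi> x = 1\<^sub>m m" "\<pi> x * \<pi> (inv x) = 1\<^sub>m m"
    using m[of x "inv x"] m[of "inv x" x] x 1 by auto
  then show "\<pi> x \<in> carrier (GL m)" using c x by (auto simp: GL_iff)
qed (use m in auto)

end

text \<open>The diagonal blocks alone determine the size of \<open>four_block_mat\<close> and where
  it is cut, so their entries can be compared directly.\<close>

lemma four_block_mat_eqD:
  assumes eq: "four_block_mat A B C D = four_block_mat A' B' C' D'"
    and "A \<in> carrier_mat d d" "A' \<in> carrier_mat d d" "D \<in> carrier_mat e e" "D' \<in> carrier_mat e e"
  shows "A = A'" "D = D'"
proof -
  show "A = A'"
  proof (rule eq_matI)
    fix i j assume ij: "i < dim_row A'" "j < dim_col A'"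
    have "four_block_mat A B C D $$ (i, j) = four_block_mat A' B' C' D' $$ (i, j)" using eq by simp
    then show "A $$ (i, j) = A' $$ (i, j)" using ij assms(2-5) by simp
  qed (use assms in auto)
  show "D = D'"
  proof (rule eq_matI)
    fix i j assume ij: "i < dim_row D'" "j < dim_col D'"
    have "four_block_mat A B C D $$ (i + d, j + d) = four_block_mat A' B' C' D' $$ (i + d, j + d)"
      using eq by simp
    then show "D $$ (i, j) = D' $$ (i, j)" using ij assms(2-5) by simp
  qed (use assms in auto)
qed

context group
begin

lemma representation_conjugate:
  assumes \<pi>: "representation G m \<pi>" and T: "T \<in> carrier_mat m m" "S \<in> carrier_mat m m"
    and ST: "S * T = 1\<^sub>m m" "T * S = 1\<^sub>m m"
  shows "representation G m (\<lambda>x. S * \<pi> x * T)"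
proof (rule representationI)
  note r = representationD[OF \<pi>]
  fix x y assume xy: "x \<in> carrier G" "y \<in> carrier G"
  note c = r(1)[OF xy(1)] r(1)[OF xy(2)] T
  have "S * \<pi> x * T * (S * \<pi> y * T) = S * \<pi> x * (T * S) * (\<pi> y * T)"
    using c by (simp add: assoc_mult_mat[of _ m m _ m _ m])
  also have "\<dots> = S * (\<pi> x * \<pi> y) * T" unfolding ST
    using c by (simp add: assoc_mult_mat[of _ m m _ m _ m])
  finally show "S * \<pi> (x \<otimes> y) * T = S * \<pi> x * T * (S * \<pi> y * T)" using r(2)[OF xy] by simp
qed (use representationD[OF \<pi>] T ST in auto)

text \<open>Block triangular matrices multiply diagonal block by diagonal block. The upper left
  block is the action on the invariant subspace, the lower right one the action on the
  quotient.\<close>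

lemma representation_blocks:
  assumes \<sigma>: "representation G (d + e) \<sigma>"
    and blk: "\<And>x. x \<in> carrier G \<Longrightarrow> \<sigma> x = four_block_mat (\<pi>\<^sub>1 x) (B x) (0\<^sub>m e d) (\<pi>\<^sub>2 x)"
    and c: "\<And>x. x \<in> carrier G \<Longrightarrow> \<pi>\<^sub>1 x \<in> carrier_mat d d"
      "\<And>x. x \<in> carrier G \<Longrightarrow> B x \<in> carrier_mat d e"
      "\<And>x. x \<in> carrier G \<Longrightarrow> \<pi>\<^sub>2 x \<in> carrier_mat e e"
  shows "representation G d \<pi>\<^sub>1" "representation G e \<pi>\<^sub>2"
proof -
  note r = representationD[OF \<sigma>]
  have m: "\<pi>\<^sub>1 (x \<otimes> y) = \<pi>\<^sub>1 x * \<pi>\<^sub>1 y \<and> \<pi>\<^sub>2 (x \<otimes> y) = \<pi>\<^sub>2 x * \<pi>\<^sub>2 y"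
    if xy: "x \<in> carrier G" "y \<in> carrier G" for x y
  proof -
    note cx = c[OF xy(1)] and cy = c[OF xy(2)] and cxy = c[OF m_closed[OF xy]]
    have L: "four_block_mat (\<pi>\<^sub>1 (x \<otimes> y)) (B (x \<otimes> y)) (0\<^sub>m e d) (\<pi>\<^sub>2 (x \<otimes> y)) = \<sigma> x * \<sigma> y"
      using blk[of "x \<otimes> y"] r(2)[OF xy] xy by simp
    have R: "\<sigma> x * \<sigma> y = four_block_mat (\<pi>\<^sub>1 x * \<pi>\<^sub>1 y + B x * 0\<^sub>m e d) (\<pi>\<^sub>1 x * B y + B x * \<pi>\<^sub>2 y)
        (0\<^sub>m e d * \<pi>\<^sub>1 y + \<pi>\<^sub>2 x * 0\<^sub>m e d) (0\<^sub>m e d * B y + \<pi>\<^sub>2 x * \<pi>\<^sub>2 y)"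
      unfolding blk[OF xy(1)] blk[OF xy(2)] by (rule mult_four_block_mat) (use cx cy in auto)
    from four_block_mat_eqD[OF trans[OF L R], of d e] show ?thesis using cx cy cxy by auto
  qed
  have "four_block_mat (\<pi>\<^sub>1 \<one>) (B \<one>) (0\<^sub>m e d) (\<pi>\<^sub>2 \<one>)
      = four_block_mat (1\<^sub>m d) (0\<^sub>m d e) (0\<^sub>m e d) (1\<^sub>m e)"
    using blk[of \<one>] r(3) by simp
  from four_block_mat_eqD[OF this, of d e] have "\<pi>\<^sub>1 \<one> = 1\<^sub>m d" "\<pi>\<^sub>2 \<one> = 1\<^sub>m e" using c by auto
  with m c show "representation G d \<pi>\<^sub>1" "representation G e \<pi>\<^sub>2"
    by (auto intro!: representationI)
qed

text \<open>In coordinates adapted to W the first d basis vectors lie in W, and elements of W have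
  no coordinates from d on. Invariance therefore clears the lower left block.\<close>

lemma reducible_blocks:
  assumes \<pi>: "representation G m \<pi>"
    and W: "VectorSpace.subspace class_ring W (module_vec TYPE(complex) m)"
    and inv: "\<And>x w. x \<in> carrier G \<Longrightarrow> w \<in> W \<Longrightarrow> \<pi> x *\<^sub>v w \<in> W"
    and W0: "W \<noteq> {0\<^sub>v m}" and W1: "W \<noteq> carrier_vec m"
  obtains d e T S \<pi>\<^sub>1 \<pi>\<^sub>2 B where "m = d + e" "d > 0" "e > 0"
    "T \<in> carrier_mat m m" "S \<in> carrier_mat m m" "S * T = 1\<^sub>m m" "T * S = 1\<^sub>m m"
    "representation G d \<pi>\<^sub>1" "representation G e \<pi>\<^sub>2"
    "\<And>x. x \<in> carrier G \<Longrightarrow> B x \<in> carrier_mat d e"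
    "\<And>x. x \<in> carrier G \<Longrightarrow> S * \<pi> x * T = four_block_mat (\<pi>\<^sub>1 x) (B x) (0\<^sub>m e d) (\<pi>\<^sub>2 x)"
proof -
  note r = representationD[OF \<pi>]
  note W' = W[unfolded subspace_iff]
  from W' have Wc: "W \<subseteq> carrier_vec m" by simp
  from adapted_basis[OF this] obtain T S d where
    T: "T \<in> carrier_mat m m" "S \<in> carrier_mat m m" "S * T = 1\<^sub>m m" "T * S = 1\<^sub>m m" and d: "d \<le> m"
    and col: "\<And>l. l < d \<Longrightarrow> col T l \<in> W"
    and zero: "\<And>w i. w \<in> W \<Longrightarrow> d \<le> i \<Longrightarrow> i < m \<Longrightarrow> (S *\<^sub>v w) $ i = 0" by blast
  define e where "e = m - d"
  have m: "m = d + e" using d by (simp add: e_def)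
  have TS: "T *\<^sub>v (S *\<^sub>v w) = w" if "w \<in> carrier_vec m" for w
    using T that by (metis assoc_mult_mat_vec one_mult_mat_vec)
  \<comment> \<open>For d = 0 every element of W would have all coordinates zero.\<close>
  have d0: "d > 0"
  proof (rule ccontr)
    assume "\<not> d > 0"
    have "w = 0\<^sub>v m" if w: "w \<in> W" for w
    proof -
      have "S *\<^sub>v w = 0\<^sub>v m" using zero[OF w] \<open>\<not> d > 0\<close> T by (intro eq_vecI) auto
      moreover have "T *\<^sub>v 0\<^sub>v m = 0\<^sub>v m" using T by (intro eq_vecI) auto
      ultimately show ?thesis using TS[of w] w Wc by auto
    qed
    with W0 W' show False by auto
  qed
  \<comment> \<open>For e = 0 every column of T would lie in W, and W would be the whole
    space.\<close>
  have e0: "e > 0"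
  proof (rule ccontr)
    assume "\<not> e > 0"
    then have "m = d" using m by simp
    have "w \<in> W" if "w \<in> carrier_vec m" for w
      using mult_mat_vec_mem[OF T(1) W, of "S *\<^sub>v w"] col \<open>m = d\<close> T that TS[OF that] by auto
    with W1 Wc show False by auto
  qed
  define \<sigma> where "\<sigma> x = S * \<pi> x * T" for x
  have \<sigma>: "representation G (d + e) \<sigma>"
    using representation_conjugate[OF \<pi> T] unfolding m \<sigma>_def .
  have \<sigma>c: "\<sigma> x \<in> carrier_mat (d + e) (d + e)" if "x \<in> carrier G" for x
    using representationD(1)[OF \<sigma> that] .
  \<comment> \<open>Column j of the conjugated matrix lists the coordinates of the image of the j-th
    basis vector, which stays in W for j < d.\<close>
  have \<sigma>0: "\<sigma> x $$ (i, j) = 0" if x: "x \<in> carrier G" and ij: "d \<le> i" "i < m" "j < d" for x i j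
  proof -
    have "\<sigma> x $$ (i, j) = col (\<sigma> x) j $ i" using \<sigma>c[OF x] ij m by simp
    also have "col (\<sigma> x) j = S *\<^sub>v (\<pi> x *\<^sub>v col T j)"
    proof -
      have "j < m" using ij d by simp
      moreover have "\<sigma> x = S * (\<pi> x * T)"
        unfolding \<sigma>_def by (rule assoc_mult_mat[of _ m m _ m _ m]) (use T r(1)[OF x] in auto)
      ultimately show ?thesis
        using col_mult2[OF T(2) mult_carrier_mat[OF r(1)[OF x] T(1)]] col_mult2[OF r(1)[OF x] T(1)]
        by (simp del: col_mult)
    qed
    also have "\<dots> $ i = 0" using zero inv[OF x col] ij by auto
    finally show ?thesis .
  qed
  define \<pi>\<^sub>1 where "\<pi>\<^sub>1 x = mat d d (\<lambda>(i, j). \<sigma> x $$ (i, j))" for x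
  define \<pi>\<^sub>2 where "\<pi>\<^sub>2 x = mat e e (\<lambda>(i, j). \<sigma> x $$ (i + d, j + d))" for x
  define B where "B x = mat d e (\<lambda>(i, j). \<sigma> x $$ (i, j + d))" for x
  have c: "\<pi>\<^sub>1 x \<in> carrier_mat d d" "B x \<in> carrier_mat d e" "\<pi>\<^sub>2 x \<in> carrier_mat e e" for x
    by (auto simp: \<pi>\<^sub>1_def \<pi>\<^sub>2_def B_def)
  have blk: "\<sigma> x = four_block_mat (\<pi>\<^sub>1 x) (B x) (0\<^sub>m e d) (\<pi>\<^sub>2 x)" if x: "x \<in> carrier G" for x
    by (rule eq_matI) (use \<sigma>c[OF x] \<sigma>0[OF x] m in \<open>auto simp: \<pi>\<^sub>1_def \<pi>\<^sub>2_def B_def\<close>)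
  from representation_blocks[OF \<sigma> blk c]
  show ?thesis using m d0 e0 T c blk by (intro that[of d e T S \<pi>\<^sub>1 \<pi>\<^sub>2 B]) (auto simp: \<sigma>_def)
qed

end

section \<open>The transform with exchanged factors\<close>

definition block_transform :: "nat \<Rightarrow> ('g \<Rightarrow> complex mat) \<Rightarrow> 'g set \<Rightarrow> nat \<Rightarrow> ('g \<Rightarrow> complex mat) \<Rightarrow> complex mat" where
  "block_transform n C X m \<pi> = mat_sum (m * n) (\<lambda>x. kronecker (\<pi> x) (C x)) X"

text \<open>By the mixed product rule, conjugation by S and T tensored with the identity acts inside
  every summand on the representation only.\<close>

lemma block_transform_conjugate:
  assumes C: "\<And>x. x \<in> X \<Longrightarrow> C x \<in> carrier_mat n n" and \<pi>: "\<And>x. x \<in> X \<Longrightarrow> \<pi> x \<in> carrier_mat m m"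
    and T: "T \<in> carrier_mat m m" "S \<in> carrier_mat m m" "S * T = 1\<^sub>m m" "T * S = 1\<^sub>m m"
    and \<sigma>: "\<And>x. x \<in> X \<Longrightarrow> \<sigma> x = S * \<pi> x * T"
  shows "similar_mat (block_transform n C X m \<sigma>) (block_transform n C X m \<pi>)"
proof -
  let ?S = "kronecker S (1\<^sub>m n)" and ?T = "kronecker T (1\<^sub>m n)"
  have k: "kronecker (\<pi> x) (C x) \<in> carrier_mat (m * n) (m * n)" if "x \<in> X" for x
    using C \<pi> that by auto
  have c: "?S \<in> carrier_mat (m * n) (m * n)" "?T \<in> carrier_mat (m * n) (m * n)" using T by auto
  have "?S * block_transform n C X m \<pi> * ?T
      = mat_sum (m * n) (\<lambda>x. ?S * kronecker (\<pi> x) (C x)) X * ?T"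
    unfolding block_transform_def by (subst mult_mat_sum[OF c(1)]) (use k in auto)
  also have "\<dots> = mat_sum (m * n) (\<lambda>x. ?S * kronecker (\<pi> x) (C x) * ?T) X"
    by (rule mat_sum_mult) (use c k in auto)
  also have "\<dots> = block_transform n C X m \<sigma>"
    unfolding block_transform_def
  proof (rule mat_sum_cong)
    fix x assume x: "x \<in> X"
    note cx = C[OF x] \<pi>[OF x]
    show "?S * kronecker (\<pi> x) (C x) * ?T = kronecker (\<sigma> x) (C x)"
      using cx T \<sigma>[OF x] by (simp add: kronecker_mult[of _ m _ _ n])
  qed
  finally have eq: "block_transform n C X m \<sigma> = ?S * block_transform n C X m \<pi> * ?T" ..
  show ?thesis
  proof (rule similar_matI[OF _ _ _ eq])
    show "?S * ?T = 1\<^sub>m (m * n)" "?T * ?S = 1\<^sub>m (m * n)"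
      using T by (simp_all add: kronecker_mult[of _ m _ _ n] kronecker_one)
  qed (use c in \<open>auto simp: block_transform_def\<close>)
qed

text \<open>An index lies below d * n exactly if its quotient by n lies below d. The cut of
  \<open>\<sigma> x\<close> at d thus becomes a cut of the whole sum at d * n.\<close>

lemma block_transform_blocks:
  assumes C: "\<And>x. x \<in> X \<Longrightarrow> C x \<in> carrier_mat n n"
    and blk: "\<And>x. x \<in> X \<Longrightarrow> \<sigma> x = four_block_mat (\<pi>\<^sub>1 x) (B x) (0\<^sub>m e d) (\<pi>\<^sub>2 x)"
    and c: "\<And>x. x \<in> X \<Longrightarrow> \<pi>\<^sub>1 x \<in> carrier_mat d d" "\<And>x. x \<in> X \<Longrightarrow> B x \<in> carrier_mat d e"
      "\<And>x. x \<in> X \<Longrightarrow> \<pi>\<^sub>2 x \<in> carrier_mat e e"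
  shows "char_poly (block_transform n C X (d + e) \<sigma>)
       = char_poly (block_transform n C X d \<pi>\<^sub>1) * char_poly (block_transform n C X e \<pi>\<^sub>2)"
proof -
  let ?b = "block_transform n C X"
  \<comment> \<open>The upper right block is cut out of the transform itself instead of being
    computed from B, since the characteristic polynomial depends on the diagonal blocks
    only.\<close>
  define U where "U = mat (d * n) (e * n) (\<lambda>(i, j). ?b (d + e) \<sigma> $$ (i, j + d * n))"
  have \<sigma>c: "\<sigma> x \<in> carrier_mat (d + e) (d + e)" if "x \<in> X" for x
    using blk c that by auto
  have ix: "?b (d + e) \<sigma> $$ (i, j)
      = (\<Sum>x\<in>X. \<sigma> x $$ (i div n, j div n) * C x $$ (i mod n, j mod n))"
    if "i < (d + e) * n" "j < (d + e) * n" for i j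
    using that C \<sigma>c by (auto simp: block_transform_def kronecker_index[of _ "d + e" _ n] intro!: sum.cong)
  have "?b (d + e) \<sigma> = four_block_mat (?b d \<pi>\<^sub>1) U (0\<^sub>m (e * n) (d * n)) (?b e \<pi>\<^sub>2)" (is "_ = ?F")
  proof (rule eq_matI)
    fix i j assume "i < dim_row ?F" "j < dim_col ?F"
    then have ij: "i < (d + e) * n" "j < (d + e) * n" by (auto simp: block_transform_def algebra_simps)
    then have n: "n > 0" by (cases n) auto
    have lt: "a div n < d \<longleftrightarrow> a < d * n" for a using n by (simp add: div_less_iff_less_mult)
    have lt': "a div n < d + e \<longleftrightarrow> a < (d + e) * n" for a using n by (simp add: div_less_iff_less_mult)
    \<comment> \<open>The shift d * n is a multiple of n: it lowers the quotient by d and keeps the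
      remainder.\<close>
    have ge: "(a - d * n) div n = a div n - d" "(a - d * n) mod n = a mod n"
      if "\<not> a < d * n" for a
    proof -
      have "d * n \<le> a" using that by simp
      then obtain b where "a = d * n + b" using le_Suc_ex by blast
      then show "(a - d * n) div n = a div n - d" "(a - d * n) mod n = a mod n" using n by auto
    qed
    consider "i < d * n" "j < d * n" | "i < d * n" "\<not> j < d * n" | "\<not> i < d * n" "j < d * n"
      | "\<not> i < d * n" "\<not> j < d * n" by blast
    then show "?b (d + e) \<sigma> $$ (i, j) = ?F $$ (i, j)"
    proof cases
      case 1
      then have "?F $$ (i, j) = ?b d \<pi>\<^sub>1 $$ (i, j)" by (simp add: block_transform_def)
      also have "\<dots> = (\<Sum>x\<in>X. \<pi>\<^sub>1 x $$ (i div n, j div n) * C x $$ (i mod n, j mod n))"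
        using 1 C c by (auto simp: block_transform_def kronecker_index[of _ d _ n] intro!: sum.cong)
      also have "\<dots> = ?b (d + e) \<sigma> $$ (i, j)"
        unfolding ix[OF ij]
      proof (rule sum.cong)
        fix x assume x: "x \<in> X"
        show "\<pi>\<^sub>1 x $$ (i div n, j div n) * C x $$ (i mod n, j mod n)
          = \<sigma> x $$ (i div n, j div n) * C x $$ (i mod n, j mod n)"
          using 1 lt[of i] lt[of j] c[OF x] unfolding blk[OF x] by auto
      qed simp
      finally show ?thesis ..
    next
      case 2
      then show ?thesis using ij by (auto simp: block_transform_def U_def algebra_simps)
    next
      case 3
      then have "?F $$ (i, j) = 0" using ij by (auto simp: block_transform_def algebra_simps)
      moreover have "\<sigma> x $$ (i div n, j div n) = 0" if x: "x \<in> X" for x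
        using 3 lt[of i] lt[of j] lt'[of i] ij c[OF x] unfolding blk[OF x] by auto
      ultimately show ?thesis using ix[OF ij] by simp
    next
      case 4
      then have b: "i - d * n < e * n" "j - d * n < e * n" using ij by (auto simp: algebra_simps)
      from 4 have "?F $$ (i, j) = ?b e \<pi>\<^sub>2 $$ (i - d * n, j - d * n)"
        using ij by (auto simp: block_transform_def algebra_simps)
      also have "\<dots> = (\<Sum>x\<in>X. \<pi>\<^sub>2 x $$ (i div n - d, j div n - d) * C x $$ (i mod n, j mod n))"
        using b C c by (auto simp: block_transform_def kronecker_index[of _ e _ n] ge 4 intro!: sum.cong)
      also have "\<dots> = ?b (d + e) \<sigma> $$ (i, j)"
        unfolding ix[OF ij]
      proof (rule sum.cong)
        fix x assume x: "x \<in> X"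
        show "\<pi>\<^sub>2 x $$ (i div n - d, j div n - d) * C x $$ (i mod n, j mod n)
          = \<sigma> x $$ (i div n, j div n) * C x $$ (i mod n, j mod n)"
          using 4 lt[of i] lt[of j] lt'[of i] lt'[of j] ij c[OF x] unfolding blk[OF x] by auto
      qed simp
      finally show ?thesis ..
    qed
  qed (auto simp: block_transform_def algebra_simps)
  then show ?thesis
  proof (rule char_poly_0_block)
    show "?b d \<pi>\<^sub>1 \<in> carrier_mat (d * n) (d * n)" "?b e \<pi>\<^sub>2 \<in> carrier_mat (e * n) (e * n)"
      by (simp_all add: block_transform_def)
    \<comment> \<open>\<open>char_poly_0_block\<close> wants linear factors, which exist over the
      complex numbers.\<close>
    then show "\<exists>es. char_poly (?b d \<pi>\<^sub>1) = (\<Prod>a\<leftarrow>es. [:- a, 1:])"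
      "\<exists>es. char_poly (?b e \<pi>\<^sub>2) = (\<Prod>a\<leftarrow>es. [:- a, 1:])"
      using char_poly_factorized by blast+
  qed (simp add: U_def)
qed

lemma mat_trace_blocks:
  assumes "A \<in> carrier_mat d d" "B \<in> carrier_mat d e" "D \<in> carrier_mat e e"
  shows "mat_trace (four_block_mat A B (0\<^sub>m e d) D) = mat_trace A + mat_trace D"
proof -
  have "(\<Sum>i<d + e. f i) = (\<Sum>i<d. f i) + (\<Sum>i<e. f (d + i))" for f :: "nat \<Rightarrow> complex"
    by (induction e) (auto simp: add.assoc)
  then show ?thesis using assms by (simp add: mat_trace_def)
qed

text \<open>Passing to a composition series instead of a direct sum avoids Maschke's theorem: traces and
  characteristic polynomials only see the diagonal blocks.\<close>

lemma (in group) irreducible_constituents: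
  assumes "representation G m \<pi>" and ps: "complete_system G ps"
  shows "\<exists>qs. set qs \<subseteq> set ps
      \<and> (\<forall>x\<in>carrier G. mat_trace (\<pi> x) = (\<Sum>(l, \<rho>)\<leftarrow>qs. mat_trace (\<rho> x)))
      \<and> (\<forall>n C. (\<forall>x\<in>carrier G. C x \<in> carrier_mat n n) \<longrightarrow>
           char_poly (block_transform n C (carrier G) m \<pi>)
             = (\<Prod>(l, \<rho>)\<leftarrow>qs. char_poly (block_transform n C (carrier G) l \<rho>)))"
  using assms(1)
proof (induction m arbitrary: \<pi> rule: less_induct)
  case (less m)
  note r = representationD[OF less.prems]
  consider "m = 0" | "irreducible_rep G m \<pi>" | "m > 0" "\<not> irreducible_rep G m \<pi>" by auto
  then show ?case
  proof cases
    \<comment> \<open>An irreducible representation has positive degree, so degree 0 is separate: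
      trace 0 and characteristic polynomial 1 match the empty list.\<close>
    case 1
    have "char_poly (block_transform n C (carrier G) m \<pi>) = 1" for n C
      using 1 by (simp add: block_transform_def char_poly_def char_poly_matrix_def)
    moreover have "mat_trace (\<pi> x) = 0" if "x \<in> carrier G" for x
      using r(1)[OF that] 1 by (simp add: mat_trace_def)
    ultimately show ?thesis by (intro exI[of _ "[]"]) auto
  next
    case 2
    with ps have "\<exists>\<rho>\<in>set ps. equivalent_rep G (m, \<pi>) \<rho>" by (simp add: complete_system_def)
    then obtain l \<rho> where \<rho>: "(l, \<rho>) \<in> set ps" and eq: "equivalent_rep G (m, \<pi>) (l, \<rho>)"
      by auto
    from eq have l: "l = m" by (simp add: equivalent_rep_def)
    from eq obtain T S where T: "T \<in> carrier_mat m m" "S \<in> carrier_mat m m" "S * T = 1\<^sub>m m" "T * S = 1\<^sub>m m"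
      and tw: "\<And>x. x \<in> carrier G \<Longrightarrow> T * \<pi> x = \<rho> x * T"
      by (auto simp: equivalent_rep_def GL_iff)
    from \<rho> ps have "representation G m \<rho>" by (auto simp: complete_system_def irreducible_rep_def l)
    note r' = representationD[OF this]
    have conj: "\<pi> x = S * \<rho> x * T" if x: "x \<in> carrier G" for x
    proof -
      have "S * \<rho> x * T = S * (T * \<pi> x)" using T r'(1)[OF x] tw[OF x] by (simp add: assoc_mult_mat[of _ m m _ m _ m])
      also have "\<dots> = S * T * \<pi> x"
        by (rule assoc_mult_mat[symmetric, of _ m m _ m _ m]) (use T r(1)[OF x] in auto)
      also have "\<dots> = \<pi> x" using T r(1)[OF x] by simp
      finally show ?thesis ..
    qed
    have "similar_mat (\<pi> x) (\<rho> x)" if x: "x \<in> carrier G" for x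
      by (rule similar_matI[OF _ T(3,4) conj[OF x]]) (use T r(1)[OF x] r'(1)[OF x] in auto)
    then have "mat_trace (\<pi> x) = mat_trace (\<rho> x)" if "x \<in> carrier G" for x
      using that mat_trace_similar by blast
    moreover have "char_poly (block_transform n C (carrier G) m \<pi>) = char_poly (block_transform n C (carrier G) l \<rho>)"
      if C: "\<forall>x\<in>carrier G. C x \<in> carrier_mat n n" for n C
      unfolding l
      by (rule char_poly_similar, rule block_transform_conjugate[OF _ _ T conj]) (use C r'(1) in auto)
    ultimately show ?thesis using \<rho> by (intro exI[of _ "[(l, \<rho>)]"]) auto
  next
    case 3
    with less.prems obtain W where W: "VectorSpace.subspace class_ring W (module_vec TYPE(complex) m)"
      and W': "\<And>x w. x \<in> carrier G \<Longrightarrow> w \<in> W \<Longrightarrow> \<pi> x *\<^sub>v w \<in> W" "W \<noteq> {0\<^sub>v m}" "W \<noteq> carrier_vec m"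
      by (auto simp: irreducible_rep_def)
    obtain d e T S \<pi>\<^sub>1 \<pi>\<^sub>2 B where de: "m = d + e" "d > 0" "e > 0"
      and T: "T \<in> carrier_mat m m" "S \<in> carrier_mat m m" "S * T = 1\<^sub>m m" "T * S = 1\<^sub>m m"
      and rep: "representation G d \<pi>\<^sub>1" "representation G e \<pi>\<^sub>2"
      and B: "\<And>x. x \<in> carrier G \<Longrightarrow> B x \<in> carrier_mat d e"
      and blk: "\<And>x. x \<in> carrier G \<Longrightarrow> S * \<pi> x * T = four_block_mat (\<pi>\<^sub>1 x) (B x) (0\<^sub>m e d) (\<pi>\<^sub>2 x)"
      using reducible_blocks[OF less.prems W W'] by metis
    note r1 = representationD(1)[OF rep(1)] and r2 = representationD(1)[OF rep(2)]
    \<comment> \<open>Both blocks are nonempty, so both degrees are smaller than m.\<close>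
    from less.IH[OF _ rep(1)] de obtain q1 where q1: "set q1 \<subseteq> set ps"
      "\<forall>x\<in>carrier G. mat_trace (\<pi>\<^sub>1 x) = (\<Sum>(l, \<rho>)\<leftarrow>q1. mat_trace (\<rho> x))"
      "\<And>n C. (\<forall>x\<in>carrier G. C x \<in> carrier_mat n n) \<Longrightarrow> char_poly (block_transform n C (carrier G) d \<pi>\<^sub>1)
             = (\<Prod>(l, \<rho>)\<leftarrow>q1. char_poly (block_transform n C (carrier G) l \<rho>))" by force
    from less.IH[OF _ rep(2)] de obtain q2 where q2: "set q2 \<subseteq> set ps"
      "\<forall>x\<in>carrier G. mat_trace (\<pi>\<^sub>2 x) = (\<Sum>(l, \<rho>)\<leftarrow>q2. mat_trace (\<rho> x))"
      "\<And>n C. (\<forall>x\<in>carrier G. C x \<in> carrier_mat n n) \<Longrightarrow> char_poly (block_transform n C (carrier G) e \<pi>\<^sub>2)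
             = (\<Prod>(l, \<rho>)\<leftarrow>q2. char_poly (block_transform n C (carrier G) l \<rho>))" by force
    have "similar_mat (S * \<pi> x * T) (\<pi> x)" if x: "x \<in> carrier G" for x
      by (rule similar_matI[OF _ T(3,4) refl]) (use T r(1)[OF x] in auto)
    then have "mat_trace (\<pi> x) = mat_trace (\<pi>\<^sub>1 x) + mat_trace (\<pi>\<^sub>2 x)" if x: "x \<in> carrier G" for x
      using mat_trace_similar[of "S * \<pi> x * T" "\<pi> x"] x mat_trace_blocks[OF r1[OF x] B[OF x] r2[OF x]]
      unfolding blk[OF x] by (metis blk)
    moreover have "char_poly (block_transform n C (carrier G) m \<pi>)
        = char_poly (block_transform n C (carrier G) d \<pi>\<^sub>1) * char_poly (block_transform n C (carrier G) e \<pi>\<^sub>2)"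
      if C: "\<forall>x\<in>carrier G. C x \<in> carrier_mat n n" for n C
    proof -
      have "similar_mat (block_transform n C (carrier G) m (\<lambda>x. S * \<pi> x * T)) (block_transform n C (carrier G) m \<pi>)"
        by (rule block_transform_conjugate[OF _ _ T]) (use C r(1) in auto)
      from char_poly_similar[OF this] show ?thesis
        using block_transform_blocks[of "carrier G" C n "\<lambda>x. S * \<pi> x * T" \<pi>\<^sub>1 B e d \<pi>\<^sub>2] blk r1 r2 B C de(1)
        by simp
    qed
    ultimately show ?thesis using q1 q2 by (intro exI[of _ "q1 @ q2"]) auto
  qed
qed

section \<open>Schur orthogonality and the regular representation\<close>

context group
begin

text \<open>Kernel and image of T are invariant. Since T is nonzero, irreducibility makes the kernel
  zero and the image everything.\<close>

lemma schur:
  assumes \<pi>: "irreducible_rep G m \<pi>" and \<rho>: "irreducible_rep G l \<rho>"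
    and T: "T \<in> carrier_mat l m" and tw: "\<And>x. x \<in> carrier G \<Longrightarrow> T * \<pi> x = \<rho> x * T"
    and T0: "T \<noteq> 0\<^sub>m l m"
  shows "l = m" "T \<in> carrier (GL m)"
proof -
  from \<pi> \<rho> have r: "representation G m \<pi>" "representation G l \<rho>" by (auto simp: irreducible_rep_def)
  note r1 = representationD(1)[OF r(1)] and r2 = representationD(1)[OF r(2)]
  have tw': "T *\<^sub>v (\<pi> x *\<^sub>v v) = \<rho> x *\<^sub>v (T *\<^sub>v v)" if "x \<in> carrier G" "v \<in> carrier_vec m" for x v
    using tw[OF that(1)] assoc_mult_mat_vec[OF T r1[OF that(1)] that(2)]
      assoc_mult_mat_vec[OF r2[OF that(1)] T that(2)] by simp
  have "\<exists>v\<in>carrier_vec m. T *\<^sub>v v \<noteq> 0\<^sub>v l"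
  proof (rule ccontr)
    assume "\<not> ?thesis"
    then have z: "col T j = 0\<^sub>v l" if "j < m" for j using mult_unit_vec[OF T that] by auto
    have "T $$ (i, j) = 0" if "i < l" "j < m" for i j
      using arg_cong[OF z[OF that(2)], of "\<lambda>v. v $ i"] that T by simp
    then have "T = 0\<^sub>m l m" using T by (intro eq_matI) auto
    with T0 show False by simp
  qed
  then obtain v0 where v0: "v0 \<in> carrier_vec m" "T *\<^sub>v v0 \<noteq> 0\<^sub>v l" by auto
  define K where "K = {v \<in> carrier_vec m. T *\<^sub>v v = 0\<^sub>v l}"
  define I where "I = (\<lambda>v. T *\<^sub>v v) ` carrier_vec m"
  have z: "A *\<^sub>v 0\<^sub>v q = 0\<^sub>v p" if "A \<in> carrier_mat p q" for A :: "complex mat" and p q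
    using that by (intro eq_vecI) auto
  have "VectorSpace.subspace class_ring K (module_vec TYPE(complex) m)"
    unfolding subspace_iff K_def
    using T z[OF T] by (auto simp: mult_add_distrib_mat_vec[OF T] mult_mat_vec[OF T])
  moreover have "\<forall>x\<in>carrier G. \<forall>w\<in>K. \<pi> x *\<^sub>v w \<in> K"
    using tw' mult_mat_vec_carrier[OF r1] z[OF r2] by (auto simp: K_def)
  ultimately have "K = {0\<^sub>v m} \<or> K = carrier_vec m"
    using \<pi> by (simp add: irreducible_rep_def)
  with v0 have K: "K = {0\<^sub>v m}" by (auto simp: K_def)
  have "VectorSpace.subspace class_ring I (module_vec TYPE(complex) l)"
    unfolding subspace_iff
  proof (intro conjI ballI allI)
    show "I \<subseteq> carrier_vec l" using T by (auto simp: I_def)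
    show "0\<^sub>v l \<in> I" using z[OF T] by (auto simp: I_def image_iff intro!: bexI[of _ "0\<^sub>v m"])
    show "v + w \<in> I" if "v \<in> I" "w \<in> I" for v w
      using that by (auto simp: I_def mult_add_distrib_mat_vec[OF T, symmetric])
    show "c \<cdot>\<^sub>v v \<in> I" if "v \<in> I" for c v
      using that by (auto simp: I_def mult_mat_vec[OF T, symmetric])
  qed
  moreover have "\<forall>x\<in>carrier G. \<forall>w\<in>I. \<rho> x *\<^sub>v w \<in> I"
    using mult_mat_vec_carrier[OF r1] by (auto simp: I_def tw'[symmetric] intro!: imageI)
  ultimately have "I = {0\<^sub>v l} \<or> I = carrier_vec l"
    using \<rho> by (simp add: irreducible_rep_def)
  with v0 have I: "I = carrier_vec l" by (auto simp: I_def)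
  \<comment> \<open>No bound on j is required: for j \<ge> l the vector \<open>unit_vec l j\<close>
    is zero. The chosen preimages become the columns of a right inverse R.\<close>
  have "\<exists>v. v \<in> carrier_vec m \<and> T *\<^sub>v v = unit_vec l j" for j
  proof -
    have "unit_vec l j \<in> I" by (simp add: I)
    then show ?thesis by (auto simp: I_def)
  qed
  then obtain v where v: "\<And>j. v j \<in> carrier_vec m" "\<And>j. T *\<^sub>v v j = unit_vec l j" by metis
  define R where "R = mat m l (\<lambda>(i, j). v j $ i)"
  have R: "R \<in> carrier_mat m l" by (simp add: R_def)
  have TR: "T * R = 1\<^sub>m l"
  proof (rule mat_col_eqI)
    fix j assume "j < dim_col (1\<^sub>m l :: complex mat)"
    then have j: "j < l" by simp
    have "col R j = v j" using j v(1)[of j] by (auto simp: R_def)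
    then show "col (T * R) j = col (1\<^sub>m l) j" using v(2) T R j by (simp del: col_mult)
  qed (use T R in auto)
  \<comment> \<open>T sends column j of R * T and the j-th unit vector to the same vector, so their
    difference lies in the zero kernel K.\<close>
  have RT: "R * T = 1\<^sub>m m"
  proof (rule mat_col_eqI)
    fix j assume "j < dim_col (1\<^sub>m m :: complex mat)"
    then have j: "j < m" by simp
    have c: "R *\<^sub>v col T j \<in> carrier_vec m" "col T j \<in> carrier_vec l" using R T by auto
    have "T *\<^sub>v (R *\<^sub>v col T j) = (T * R) *\<^sub>v col T j" by (rule assoc_mult_mat_vec[symmetric, OF T R c(2)])
    also have "\<dots> = T *\<^sub>v unit_vec m j" unfolding TR mult_unit_vec[OF T j] using c by simp
    finally have eq: "T *\<^sub>v (R *\<^sub>v col T j) = T *\<^sub>v unit_vec m j" .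
    have "T *\<^sub>v (R *\<^sub>v col T j - unit_vec m j) = T *\<^sub>v (R *\<^sub>v col T j) - T *\<^sub>v unit_vec m j"
      by (rule mult_minus_distrib_mat_vec[OF T c(1)]) simp
    also have "\<dots> = 0\<^sub>v l" unfolding eq using T by (intro eq_vecI) auto
    finally have "R *\<^sub>v col T j - unit_vec m j \<in> K" using c by (simp add: K_def)
    then have d: "R *\<^sub>v col T j - unit_vec m j = 0\<^sub>v m" using K by simp
    have "R *\<^sub>v col T j = unit_vec m j"
    proof (rule eq_vecI)
      fix i assume "i < dim_vec (unit_vec m j :: complex vec)"
      then have "(R *\<^sub>v col T j - unit_vec m j) $ i = 0" "i < m" using d by simp_all
      then show "(R *\<^sub>v col T j) $ i = unit_vec m j $ i" using c(1)
        by (simp del: index_mult_mat_vec)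
    qed (use R in auto)
    then show "col (R * T) j = col (1\<^sub>m m) j" using R T j by (simp del: col_mult)
  qed (use T R in auto)
  \<comment> \<open>The sizes agree because T * R and R * T have the same trace.\<close>
  have "of_nat l = mat_trace (1\<^sub>m l)" by (simp add: mat_trace_def)
  also have "\<dots> = mat_trace (1\<^sub>m m)" using mat_trace_comm[OF T R] by (simp add: TR RT)
  also have "\<dots> = of_nat m" by (simp add: mat_trace_def)
  finally show lm: "l = m" by simp
  show "T \<in> carrier (GL m)" using T R TR RT unfolding lm by (auto simp: GL_iff)
qed

text \<open>Subtracting an eigenvalue c from T leaves an intertwiner that kills an eigenvector. It
  is not invertible, hence zero by Schur's lemma.\<close>

lemma schur_scalar:
  assumes \<pi>: "irreducible_rep G m \<pi>" and T: "T \<in> carrier_mat m m"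
    and tw: "\<And>x. x \<in> carrier G \<Longrightarrow> T * \<pi> x = \<pi> x * T"
  obtains c where "T = c \<cdot>\<^sub>m 1\<^sub>m m"
proof -
  from \<pi> have r: "representation G m \<pi>" and m: "m > 0" by (auto simp: irreducible_rep_def)
  note r1 = representationD(1)[OF r]
  from spectrum_non_empty[OF T m] obtain c v where "eigenvector T v c"
    by (auto simp: spectrum_def eigenvalue_def)
  then have v: "v \<in> carrier_vec m" "v \<noteq> 0\<^sub>v m" "T *\<^sub>v v = c \<cdot>\<^sub>v v" using T by (auto simp: eigenvector_def)
  define U where "U = T - c \<cdot>\<^sub>m 1\<^sub>m m"
  have U: "U \<in> carrier_mat m m" unfolding U_def by (intro minus_carrier_mat) simp
  have tw': "U * \<pi> x = \<pi> x * U" if x: "x \<in> carrier G" for x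
  proof -
    have "U * \<pi> x = T * \<pi> x - c \<cdot>\<^sub>m \<pi> x"
      unfolding U_def using T r1[OF x] by (subst minus_mult_distrib_mat[of _ m m]) auto
    also have "\<dots> = \<pi> x * U"
      unfolding U_def using T r1[OF x] tw[OF x] by (subst mult_minus_distrib_mat[of _ m m]) auto
    finally show ?thesis .
  qed
  have Uv: "U *\<^sub>v v = 0\<^sub>v m"
  proof -
    have "U *\<^sub>v v = T *\<^sub>v v - (c \<cdot>\<^sub>m 1\<^sub>m m) *\<^sub>v v"
      unfolding U_def using T v by (intro minus_mult_distrib_mat_vec) auto
    also have "(c \<cdot>\<^sub>m 1\<^sub>m m) *\<^sub>v v = c \<cdot>\<^sub>v v" using v by (intro eq_vecI) auto
    finally show ?thesis using v by auto
  qed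
  have "U = 0\<^sub>m m m"
  proof (rule ccontr)
    assume "U \<noteq> 0\<^sub>m m m"
    from schur(2)[OF \<pi> \<pi> U tw' this] obtain S where S: "S \<in> carrier_mat m m" "S * U = 1\<^sub>m m"
      by (auto simp: GL_iff)
    have "v = (S * U) *\<^sub>v v" using S v by simp
    also have "\<dots> = S *\<^sub>v (U *\<^sub>v v)" by (rule assoc_mult_mat_vec[OF S(1) U v(1)])
    also have "\<dots> = 0\<^sub>v m" unfolding Uv using S by (intro eq_vecI) auto
    finally show False using v by simp
  qed
  have "T = c \<cdot>\<^sub>m 1\<^sub>m m"
  proof (rule eq_matI)
    fix i j assume "i < dim_row (c \<cdot>\<^sub>m 1\<^sub>m m)" "j < dim_col (c \<cdot>\<^sub>m 1\<^sub>m m)"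
    then have ij: "i < m" "j < m" by auto
    have "U $$ (i, j) = 0" using \<open>U = 0\<^sub>m m m\<close> ij by simp
    then show "T $$ (i, j) = (c \<cdot>\<^sub>m 1\<^sub>m m) $$ (i, j)" using ij T by (simp add: U_def)
  qed (use T in auto)
  then show ?thesis by (rule that)
qed

section \<open>Averaging over the group and orthogonality of characters\<close>

lemma sum_left_translate:
  assumes "y \<in> carrier G"
  shows "(\<Sum>x\<in>carrier G. f (y \<otimes> x)) = (\<Sum>x\<in>carrier G. f x)"
  by (rule sum.reindex_bij_witness[of _ "\<lambda>z. inv y \<otimes> z" "\<lambda>x. y \<otimes> x"])
    (use assms in \<open>auto simp: m_assoc[symmetric]\<close>)

text \<open>The sum of \<open>\<rho> x\<close> * E * \<open>\<pi> (inv x)\<close> over the group,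
  where E is the l by m matrix unit at (a, b); there is no division by the group order.\<close>

definition average :: "nat \<Rightarrow> ('a \<Rightarrow> complex mat) \<Rightarrow> nat \<Rightarrow> ('a \<Rightarrow> complex mat) \<Rightarrow> nat \<Rightarrow> nat \<Rightarrow> complex mat" where
  "average l \<rho> m \<pi> a b = mat l m (\<lambda>(i, j). \<Sum>x\<in>carrier G. \<rho> x $$ (i, a) * \<pi> (inv x) $$ (b, j))"

text \<open>Multiplication by \<open>\<rho> y\<close> from the left only reindexes the sum by
  translation and leaves a factor \<open>\<pi> y\<close> on the right.\<close>

lemma average_intertwines:
  assumes \<pi>: "representation G m \<pi>" and \<rho>: "representation G l \<rho>"
    and ab: "a < l" "b < m" and y: "y \<in> carrier G"
  shows "average l \<rho> m \<pi> a b * \<pi> y = \<rho> y * average l \<rho> m \<pi> a b" (is "?T * _ = _")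
proof -
  note p = representationD[OF \<pi>] and r = representationD[OF \<rho>]
  have T: "?T \<in> carrier_mat l m" by (simp add: average_def)
  show ?thesis
  proof (rule eq_matI)
    fix i j assume "i < dim_row (\<rho> y * ?T)" "j < dim_col (\<rho> y * ?T)"
    then have ij: "i < l" "j < m" using T r(1)[OF y] by auto
    have "(\<rho> y * ?T) $$ (i, j) = (\<Sum>c<l. \<rho> y $$ (i, c) * (\<Sum>x\<in>carrier G. \<rho> x $$ (c, a) * \<pi> (inv x) $$ (b, j)))"
      using T ij r(1)[OF y] by (simp add: scalar_prod_def atLeast0LessThan average_def)
    also have "\<dots> = (\<Sum>c<l. \<Sum>x\<in>carrier G. \<rho> y $$ (i, c) * \<rho> x $$ (c, a) * \<pi> (inv x) $$ (b, j))"
      by (simp add: sum_distrib_left mult.assoc)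
    also have "\<dots> = (\<Sum>x\<in>carrier G. \<Sum>c<l. \<rho> y $$ (i, c) * \<rho> x $$ (c, a) * \<pi> (inv x) $$ (b, j))"
      by (rule sum.swap)
    \<comment> \<open>Here inv x is rewritten as inv (y x) y, which makes the summand a function of
      y x alone.\<close>
    also have "\<dots> = (\<Sum>x\<in>carrier G. \<rho> (y \<otimes> x) $$ (i, a) * \<pi> (inv (y \<otimes> x) \<otimes> y) $$ (b, j))"
    proof (rule sum.cong)
      fix x assume x: "x \<in> carrier G"
      have "inv (y \<otimes> x) \<otimes> y = inv x" using x y by (simp add: inv_mult_group m_assoc)
      moreover have "\<rho> (y \<otimes> x) $$ (i, a) = (\<Sum>c<l. \<rho> y $$ (i, c) * \<rho> x $$ (c, a))"
        using r(2)[OF y x] r(1)[OF y] r(1)[OF x] ij ab by (simp add: scalar_prod_def atLeast0LessThan)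
      ultimately show "(\<Sum>c<l. \<rho> y $$ (i, c) * \<rho> x $$ (c, a) * \<pi> (inv x) $$ (b, j))
          = \<rho> (y \<otimes> x) $$ (i, a) * \<pi> (inv (y \<otimes> x) \<otimes> y) $$ (b, j)"
        by (simp add: sum_distrib_right)
    qed simp
    also have "\<dots> = (\<Sum>x\<in>carrier G. \<rho> x $$ (i, a) * \<pi> (inv x \<otimes> y) $$ (b, j))"
      by (rule sum_left_translate[OF y])
    also have "\<dots> = (\<Sum>x\<in>carrier G. \<Sum>c<m. \<rho> x $$ (i, a) * \<pi> (inv x) $$ (b, c) * \<pi> y $$ (c, j))"
    proof (rule sum.cong)
      fix x assume x: "x \<in> carrier G"
      have "\<pi> (inv x \<otimes> y) $$ (b, j) = (\<Sum>c<m. \<pi> (inv x) $$ (b, c) * \<pi> y $$ (c, j))"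
        using p(2)[of "inv x" y] p(1)[OF y] p(1)[of "inv x"] x y ij ab
        by (simp add: scalar_prod_def atLeast0LessThan)
      then show "\<rho> x $$ (i, a) * \<pi> (inv x \<otimes> y) $$ (b, j)
          = (\<Sum>c<m. \<rho> x $$ (i, a) * \<pi> (inv x) $$ (b, c) * \<pi> y $$ (c, j))"
        by (simp add: sum_distrib_left mult.assoc)
    qed simp
    also have "\<dots> = (\<Sum>c<m. \<Sum>x\<in>carrier G. \<rho> x $$ (i, a) * \<pi> (inv x) $$ (b, c) * \<pi> y $$ (c, j))"
      by (rule sum.swap)
    also have "\<dots> = (?T * \<pi> y) $$ (i, j)"
      using T ij p(1)[OF y] by (simp add: scalar_prod_def atLeast0LessThan average_def sum_distrib_right)
    finally show "(?T * \<pi> y) $$ (i, j) = (\<rho> y * ?T) $$ (i, j)" by simp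
  qed (use T p(1)[OF y] r(1)[OF y] in auto)
qed

text \<open>Expanding both traces pairs the diagonal entries at i and j; their sum over the group is
  the (i, j) entry of the average of the matrix unit at (i, j). The inverse stands where complex
  conjugation stands for unitary representations.\<close>

lemma character_product_average:
  assumes \<pi>: "representation G m \<pi>" and \<rho>: "representation G l \<rho>"
  shows "(\<Sum>x\<in>carrier G. mat_trace (\<rho> x) * mat_trace (\<pi> (inv x)))
       = (\<Sum>i<l. \<Sum>j<m. average l \<rho> m \<pi> i j $$ (i, j))"
proof -
  note p = representationD[OF \<pi>] and r = representationD[OF \<rho>]
  have "(\<Sum>x\<in>carrier G. mat_trace (\<rho> x) * mat_trace (\<pi> (inv x)))
      = (\<Sum>x\<in>carrier G. \<Sum>i<l. \<Sum>j<m. \<rho> x $$ (i, i) * \<pi> (inv x) $$ (j, j))"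
  proof (rule sum.cong)
    fix x assume x: "x \<in> carrier G"
    show "mat_trace (\<rho> x) * mat_trace (\<pi> (inv x)) = (\<Sum>i<l. \<Sum>j<m. \<rho> x $$ (i, i) * \<pi> (inv x) $$ (j, j))"
      using r(1)[OF x] p(1)[of "inv x"] x by (simp add: mat_trace_def sum_product)
  qed simp
  also have "\<dots> = (\<Sum>i<l. \<Sum>x\<in>carrier G. \<Sum>j<m. \<rho> x $$ (i, i) * \<pi> (inv x) $$ (j, j))"
    by (rule sum.swap)
  also have "\<dots> = (\<Sum>i<l. \<Sum>j<m. \<Sum>x\<in>carrier G. \<rho> x $$ (i, i) * \<pi> (inv x) $$ (j, j))"
    by (intro sum.cong refl sum.swap)
  finally show ?thesis by (simp add: average_def)
qed

text \<open>Every average is an intertwiner; by Schur's lemma a nonzero one would be an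
  equivalence.\<close>

lemma character_orthogonal:
  assumes \<pi>: "irreducible_rep G m \<pi>" and \<rho>: "irreducible_rep G l \<rho>"
    and ne: "\<not> equivalent_rep G (m, \<pi>) (l, \<rho>)"
  shows "(\<Sum>x\<in>carrier G. mat_trace (\<rho> x) * mat_trace (\<pi> (inv x))) = 0"
proof -
  from \<pi> \<rho> have r: "representation G m \<pi>" "representation G l \<rho>" by (auto simp: irreducible_rep_def)
  have z: "average l \<rho> m \<pi> i j = 0\<^sub>m l m" if ij: "i < l" "j < m" for i j
  proof (rule ccontr)
    assume a: "average l \<rho> m \<pi> i j \<noteq> 0\<^sub>m l m"
    have c: "average l \<rho> m \<pi> i j \<in> carrier_mat l m" by (simp add: average_def)
    note tw = average_intertwines[OF r ij]
    note s = schur[OF \<pi> \<rho> c tw a]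
    have "equivalent_rep G (m, \<pi>) (l, \<rho>)"
      unfolding equivalent_rep_def using s tw by auto
    with ne show False by simp
  qed
  show ?thesis unfolding character_product_average[OF r] by (simp add: z)
qed

text \<open>The average of the matrix unit at (a, b) is a scalar c. Its trace is c * m, but also the
  group order times the (b, a) entry of the identity, which determines c.\<close>

lemma character_norm:
  assumes \<pi>: "irreducible_rep G m \<pi>"
  shows "(\<Sum>x\<in>carrier G. mat_trace (\<pi> x) * mat_trace (\<pi> (inv x))) = of_nat (card (carrier G))"
proof -
  from \<pi> have r: "representation G m \<pi>" and m: "m > 0" by (auto simp: irreducible_rep_def)
  note p = representationD[OF r]
  define k :: complex where "k = of_nat (card (carrier G))"
  have av: "average m \<pi> m \<pi> a b $$ (a, b) = (if a = b then k / of_nat m else 0)" if ab: "a < m" "b < m" for a b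
  proof -
    let ?T = "average m \<pi> m \<pi> a b"
    have T: "?T \<in> carrier_mat m m" by (simp add: average_def)
    from schur_scalar[OF \<pi> T average_intertwines[OF r r ab]] obtain c where c: "?T = c \<cdot>\<^sub>m 1\<^sub>m m" by blast
    have "c * of_nat m = mat_trace ?T" unfolding c by (simp add: mat_trace_def)
    also have "\<dots> = (\<Sum>i<m. \<Sum>x\<in>carrier G. \<pi> x $$ (i, a) * \<pi> (inv x) $$ (b, i))"
      by (simp add: mat_trace_def average_def)
    also have "\<dots> = (\<Sum>x\<in>carrier G. \<Sum>i<m. \<pi> x $$ (i, a) * \<pi> (inv x) $$ (b, i))" by (rule sum.swap)
    also have "\<dots> = (\<Sum>x\<in>carrier G. if a = b then 1 else 0)"
    proof (rule sum.cong)
      fix x assume x: "x \<in> carrier G"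
      have "(\<Sum>i<m. \<pi> x $$ (i, a) * \<pi> (inv x) $$ (b, i)) = (\<pi> (inv x) * \<pi> x) $$ (b, a)"
        using p(1)[OF x] p(1)[of "inv x"] x ab by (simp add: scalar_prod_def atLeast0LessThan mult.commute)
      also have "\<pi> (inv x) * \<pi> x = 1\<^sub>m m" using p(2)[of "inv x" x] p(3) x by simp
      finally show "(\<Sum>i<m. \<pi> x $$ (i, a) * \<pi> (inv x) $$ (b, i)) = (if a = b then 1 else 0)"
        using ab by auto
    qed simp
    also have "\<dots> = (if a = b then k else 0)" by (simp add: k_def)
    finally have "c = (if a = b then k / of_nat m else 0)" using m by (auto simp: field_simps)
    then show ?thesis unfolding c using ab by auto
  qed
  have "(\<Sum>x\<in>carrier G. mat_trace (\<pi> x) * mat_trace (\<pi> (inv x))) = (\<Sum>i<m. \<Sum>j<m. if i = j then k / of_nat m else 0)"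
    unfolding character_product_average[OF r r] by (intro sum.cong refl) (use av in auto)
  also have "\<dots> = k" using m by simp
  finally show ?thesis by (simp add: k_def)
qed

end

section \<open>Complete systems of irreducible representations\<close>

lemma equivalent_rep_refl:
  assumes "group G" "representation G m \<pi>"
  shows "equivalent_rep G (m, \<pi>) (m, \<pi>)"
proof -
  have "1\<^sub>m m \<in> carrier (GL m)" by (auto simp: GL_iff Bex_def intro!: exI[of _ "1\<^sub>m m"])
  moreover have "1\<^sub>m m * \<pi> x = \<pi> x * 1\<^sub>m m" if "x \<in> carrier G" for x
    using group.representationD(1)[OF assms that] by simp
  ultimately show ?thesis unfolding equivalent_rep_def by auto
qed

lemma complete_system_cases:
  assumes "complete_system G ps" "p \<in> set ps" "q \<in> set ps" "p \<noteq> q"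
  shows "\<not> equivalent_rep G p q"
  using assms by (auto simp: complete_system_def in_set_conv_nth)

text \<open>Entries at different positions are inequivalent, and equivalence is reflexive, so
  nothing repeats. This permits passing from products and sums over the set to the list.\<close>

lemma complete_system_distinct:
  assumes "group G" "complete_system G ps"
  shows "distinct ps"
  unfolding distinct_conv_nth
proof (intro allI impI notI)
  fix i j assume ij: "i < length ps" "j < length ps" "i \<noteq> j" and eq: "ps ! i = ps ! j"
  obtain m \<pi> where p: "ps ! i = (m, \<pi>)" by fastforce
  then have "(m, \<pi>) \<in> set ps" using ij nth_mem by metis
  then have "representation G m \<pi>" using assms(2) by (auto simp: complete_system_def irreducible_rep_def)
  then have "equivalent_rep G (ps ! i) (ps ! j)"
    unfolding eq[symmetric] p by (rule equivalent_rep_refl[OF assms(1)])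
  then show False using assms(2) ij by (simp add: complete_system_def)
qed

section \<open>The regular representation\<close>

context group
begin

text \<open>Row r of the regular representation at x contains a single 1; s is its column.\<close>

lemma bij_enum_solve:
  assumes g: "bij_betw g {..<k} (carrier G)" and x: "x \<in> carrier G" and r: "r < k"
  obtains s where "s < k" "g s = inv x \<otimes> g r" "\<And>q. q < k \<Longrightarrow> (x = g r \<otimes> inv (g q)) \<longleftrightarrow> q = s"
proof -
  have gc: "g q \<in> carrier G" if "q < k" for q using bij_betwE[OF g] that by auto
  have "inv x \<otimes> g r \<in> g ` {..<k}" using bij_betw_imp_surj_on[OF g] gc[OF r] x by auto
  then obtain s where s: "s < k" "g s = inv x \<otimes> g r" by auto
  have "(x = g r \<otimes> inv (g q)) \<longleftrightarrow> q = s" if q: "q < k" for q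
  proof
    assume a: "x = g r \<otimes> inv (g q)"
    have "g s = g q" unfolding s(2) a using gc[OF q] gc[OF r] by (simp add: inv_mult_group m_assoc)
    then show "q = s" using bij_betw_imp_inj_on[OF g] q s(1) by (auto dest: inj_onD)
  next
    assume "q = s"
    then show "x = g r \<otimes> inv (g q)" using s gc[OF r] x by (simp add: inv_mult_group m_assoc[symmetric])
  qed
  with s that show ?thesis by blast
qed

lemma regular_representation:
  assumes g: "bij_betw g {..<k} (carrier G)"
  shows "representation G k (regular_rep G k g)"
proof (rule representationI)
  have gc: "g q \<in> carrier G" if "q < k" for q using bij_betwE[OF g] that by auto
  fix x y assume xy: "x \<in> carrier G" "y \<in> carrier G"
  show "regular_rep G k g (x \<otimes> y) = regular_rep G k g x * regular_rep G k g y" (is "?L = ?R")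
  proof (rule eq_matI)
    fix r p assume "r < dim_row ?R" "p < dim_col ?R"
    then have rp: "r < k" "p < k" by (auto simp: regular_rep_def)
    from bij_enum_solve[OF g xy(1) rp(1)] obtain s where s: "s < k" "g s = inv x \<otimes> g r"
      "\<And>q. q < k \<Longrightarrow> (x = g r \<otimes> inv (g q)) \<longleftrightarrow> q = s" by blast
    have "?R $$ (r, p) = (\<Sum>q<k. (if x = g r \<otimes> inv (g q) then 1 else 0) * (if y = g q \<otimes> inv (g p) then 1 else 0))"
      using rp by (simp add: regular_rep_def scalar_prod_def atLeast0LessThan)
    also have "\<dots> = (\<Sum>q<k. if q = s then (if y = g q \<otimes> inv (g p) then 1 else 0) else 0)"
      by (rule sum.cong) (auto simp: s(3))
    also have "\<dots> = (if y = inv x \<otimes> g r \<otimes> inv (g p) then 1 else 0)" using s by simp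
    also have "y = inv x \<otimes> g r \<otimes> inv (g p) \<longleftrightarrow> x \<otimes> y = g r \<otimes> inv (g p)"
      using gc[OF rp(1)] gc[OF rp(2)] xy by (metis inv_closed inv_solve_left m_assoc m_closed)
    finally show "?L $$ (r, p) = ?R $$ (r, p)" using rp by (simp add: regular_rep_def)
  qed (auto simp: regular_rep_def)
next
  show "regular_rep G k g \<one> = 1\<^sub>m k"
  proof (rule eq_matI)
    fix r p assume "r < dim_row (1\<^sub>m k :: complex mat)" "p < dim_col (1\<^sub>m k :: complex mat)"
    then have rp: "r < k" "p < k" by auto
    have gc: "g q \<in> carrier G" if "q < k" for q using bij_betwE[OF g] that by auto
    from bij_enum_solve[OF g one_closed rp(1)] obtain s where s: "s < k" "g s = inv \<one> \<otimes> g r"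
      "\<And>q. q < k \<Longrightarrow> (\<one> = g r \<otimes> inv (g q)) \<longleftrightarrow> q = s" by blast
    have "g s = g r" using s gc[OF rp(1)] by simp
    then have "s = r" using bij_betw_imp_inj_on[OF g] rp s(1) by (auto dest: inj_onD)
    then show "regular_rep G k g \<one> $$ (r, p) = 1\<^sub>m k $$ (r, p)"
      using s(3)[OF rp(2)] rp by (auto simp: regular_rep_def)
  qed (auto simp: regular_rep_def)
qed (simp add: regular_rep_def)

lemma regular_trace:
  assumes g: "bij_betw g {..<k} (carrier G)" and x: "x \<in> carrier G"
  shows "mat_trace (regular_rep G k g x) = (if x = \<one> then of_nat k else 0)"
proof -
  have gc: "g q \<in> carrier G" if "q < k" for q using bij_betwE[OF g] that by auto
  have "mat_trace (regular_rep G k g x) = (\<Sum>r<k. if x = g r \<otimes> inv (g r) then 1 else 0)"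
    by (simp add: mat_trace_def regular_rep_def)
  also have "\<dots> = (\<Sum>r<k. if x = \<one> then 1 else 0)" by (rule sum.cong) (auto simp: gc)
  finally show ?thesis by simp
qed

text \<open>Both expressions for the regular character are paired with the character of
  \<open>\<pi>\<close> at inverses. The left side keeps only the identity and gives k * m; on the
  right, orthogonality leaves k for each occurrence of \<open>(m, \<pi>)\<close>.\<close>

lemma regular_multiplicity:
  assumes fin: "finite (carrier G)" and g: "bij_betw g {..<k} (carrier G)"
    and ps: "complete_system G ps" and qs: "set qs \<subseteq> set ps"
    and tr: "\<And>x. x \<in> carrier G \<Longrightarrow> mat_trace (regular_rep G k g x) = (\<Sum>(l, \<rho>)\<leftarrow>qs. mat_trace (\<rho> x))"
    and p: "(m, \<pi>) \<in> set ps"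
  shows "count_list qs (m, \<pi>) = m"
proof -
  have irr: "irreducible_rep G (fst q) (snd q)" if "q \<in> set ps" for q
    using ps that by (auto simp: complete_system_def)
  have k: "card (carrier G) = k" using bij_betw_same_card[OF g] by simp
  have k0: "k \<noteq> 0" using k fin one_closed card_gt_0_iff[of "carrier G"] by auto
  have \<pi>: "irreducible_rep G m \<pi>" using irr[OF p] by simp
  then have r: "representation G m \<pi>" by (simp add: irreducible_rep_def)
  have "of_nat k * of_nat m = (\<Sum>x\<in>carrier G. mat_trace (regular_rep G k g x) * mat_trace (\<pi> (inv x)))"
  proof -
    have "(\<Sum>x\<in>carrier G. mat_trace (regular_rep G k g x) * mat_trace (\<pi> (inv x)))
        = (\<Sum>x\<in>carrier G. if x = \<one> then of_nat k * mat_trace (\<pi> (inv x)) else 0)"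
      by (rule sum.cong) (auto simp: regular_trace[OF g])
    also have "\<dots> = of_nat k * mat_trace (\<pi> \<one>)" using fin by simp
    also have "mat_trace (\<pi> \<one>) = of_nat m" using representationD(3)[OF r] by (simp add: mat_trace_def)
    finally show ?thesis ..
  qed
  also have "\<dots> = (\<Sum>x\<in>carrier G. \<Sum>q\<leftarrow>qs. mat_trace (snd q x) * mat_trace (\<pi> (inv x)))"
    by (rule sum.cong) (auto simp: tr sum_list_mult_const[symmetric] case_prod_unfold)
  also have "\<dots> = (\<Sum>q\<leftarrow>qs. \<Sum>x\<in>carrier G. mat_trace (snd q x) * mat_trace (\<pi> (inv x)))"
    by (induction qs) (auto simp: sum.distrib)
  \<comment> \<open>The constituents are entries of ps itself, so one that differs from
    \<open>(m, \<pi>)\<close> as a pair is already inequivalent to it.\<close>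
  also have "\<dots> = (\<Sum>q\<leftarrow>qs. if q = (m, \<pi>) then of_nat k else 0)"
  proof (rule arg_cong[of _ _ sum_list], rule map_cong[OF refl])
    fix q assume "q \<in> set qs"
    then have q: "q \<in> set ps" using qs by auto
    show "(\<Sum>x\<in>carrier G. mat_trace (snd q x) * mat_trace (\<pi> (inv x))) = (if q = (m, \<pi>) then of_nat k else 0)"
    proof (cases "q = (m, \<pi>)")
      case True
      then show ?thesis using character_norm[OF \<pi>] k by simp
    next
      case False
      then have "\<not> equivalent_rep G (m, \<pi>) (fst q, snd q)"
        using complete_system_cases[OF ps p q] by auto
      from character_orthogonal[OF \<pi> irr[OF q] this] False show ?thesis by simp
    qed
  qed
  also have "\<dots> = of_nat k * of_nat (count_list qs (m, \<pi>))"
    by (induction qs) (auto simp: algebra_simps)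
  \<comment> \<open>The factor k cancels because a finite group has nonzero order; natural numbers
    embed injectively into the complex numbers.\<close>
  finally have "(of_nat m :: complex) = of_nat (count_list qs (m, \<pi>))" using k0 by simp
  then show ?thesis by simp
qed

end

section \<open>Passage to the spectrum of the circulant matrix\<close>

lemma prod_list_eq_prod_count:
  fixes f :: "'a \<Rightarrow> 'b::comm_monoid_mult"
  assumes "finite S" "set qs \<subseteq> S"
  shows "(\<Prod>q\<leftarrow>qs. f q) = (\<Prod>p\<in>S. f p ^ count_list qs p)"
  using assms(2)
proof (induction qs)
  case (Cons q qs)
  have "(\<Prod>p\<in>S. f p ^ count_list (q # qs) p)
      = (\<Prod>p\<in>S. f p ^ count_list qs p * (if p = q then f p else 1))"
    by (rule prod.cong) (auto simp: mult.commute)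
  also have "\<dots> = (\<Prod>p\<in>S. f p ^ count_list qs p) * f q"
    using Cons.prems assms(1) by (simp add: prod.distrib)
  finally show ?case using Cons by (simp add: mult.commute)
qed simp

text \<open>The index permutation that exchanges the factors is the same for every x, so it passes
  through the sum.\<close>

lemma fourier_similar:
  assumes fin: "finite (carrier G)" and F: "F \<in> mat_group_algebra G n"
    and \<pi>: "\<And>x. x \<in> carrier G \<Longrightarrow> \<pi> x \<in> carrier_mat m m"
  defines "B \<equiv> block_transform n (coeff_mat F) (carrier G) m \<pi>"
  shows "fourier G n F m \<pi> = mat (n * m) (n * m) (\<lambda>(i, j). B $$ (transpose_index m n i, transpose_index m n j))"
    and "similar_mat (fourier G n F m \<pi>) B"
proof -
  have C: "coeff_mat F x \<in> carrier_mat n n" for x using F by (auto simp: coeff_mat_def mat_group_algebra_def)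
  have per: "transpose_index m n permutes {..<n * m}"
    using transpose_index_permutes[of m n] by (simp add: mult.commute)
  then have lt: "transpose_index m n i < n * m" if "i < n * m" for i
    using permutes_in_image[OF per, of i] that by simp
  have "fourier G n F m \<pi> = mat_sum (n * m) (\<lambda>x. kronecker (coeff_mat F x) (\<pi> x)) (carrier G)"
    unfolding fourier_def by (rule finsum_module_mat) (use fin C \<pi> in auto)
  also have "\<dots> = mat (n * m) (n * m) (\<lambda>(i, j). B $$ (transpose_index m n i, transpose_index m n j))"
    by (rule eq_matI)
      (use lt C \<pi> kronecker_swap[of _ n _ m] in \<open>auto simp: B_def block_transform_def mult.commute[of m n] intro!: sum.cong\<close>)
  finally show eq: "fourier G n F m \<pi> = mat (n * m) (n * m) (\<lambda>(i, j). B $$ (transpose_index m n i, transpose_index m n j))" .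
  show "similar_mat (fourier G n F m \<pi>) B"
    unfolding eq by (rule permutation_conjugate(2)[OF per]) (simp add: B_def block_transform_def mult.commute)
qed

text \<open>In block (r, p) of the transform only x = g r * inv (g p) contributes. Writing this
  element as g s, the circulant condition together with g 0 = 1 identifies block (s, 0), which
  defines M there, with block (r, p).\<close>

lemma (in group) block_circulant_eq_block_transform:
  assumes g: "bij_betw g {..<k} (carrier G)" and g0: "g 0 = \<one>"
    and A: "block_circulant G k g n A" and M: "associated G k g n A M"
    and fin: "finite (carrier G)"
  shows "A = block_transform n (coeff_mat M) (carrier G) k (regular_rep G k g)"
proof (rule eq_matI)
  let ?B = "block_transform n (coeff_mat M) (carrier G) k (regular_rep G k g)"
  have Ac: "A \<in> carrier_mat (n * k) (n * k)" using A by (simp add: block_circulant_def)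
  then show "dim_row A = dim_row ?B" "dim_col A = dim_col ?B"
    by (auto simp: block_transform_def mult.commute)
  have gc: "g q \<in> carrier G" if "q < k" for q using bij_betwE[OF g] that by auto
  have C: "coeff_mat M x \<in> carrier_mat n n" for x
    using M by (auto simp: associated_def coeff_mat_def mat_group_algebra_def)
  fix i j assume "i < dim_row ?B" "j < dim_col ?B"
  then have ij: "i < k * n" "j < k * n" by (auto simp: block_transform_def)
  then have n: "n > 0" by (cases n) auto
  define r p where "r = i div n" and "p = j div n"
  have rp: "r < k" "p < k" using ij n by (auto simp: r_def p_def less_mult_imp_div_less)
  have "g r \<otimes> inv (g p) \<in> g ` {..<k}" using bij_betw_imp_surj_on[OF g] gc rp by auto
  then obtain s where s: "s < k" "g s = g r \<otimes> inv (g p)" by auto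
  have k0: "0 < k" using rp by simp
  have "?B $$ (i, j) = (\<Sum>x\<in>carrier G. kronecker (regular_rep G k g x) (coeff_mat M x) $$ (i, j))"
    using ij by (simp add: block_transform_def)
  also have "\<dots> = (\<Sum>x\<in>carrier G. if x = g s then coeff_mat M x $$ (i mod n, j mod n) else 0)"
  proof (rule sum.cong)
    fix x
    have "regular_rep G k g x \<in> carrier_mat k k" by (simp add: regular_rep_def)
    then show "kronecker (regular_rep G k g x) (coeff_mat M x) $$ (i, j)
        = (if x = g s then coeff_mat M x $$ (i mod n, j mod n) else 0)"
      using ij C rp by (simp add: kronecker_index[of _ k _ n] r_def[symmetric] p_def[symmetric])
        (simp add: regular_rep_def s)
  qed simp
  also have "\<dots> = coeff_mat M (g s) $$ (i mod n, j mod n)" using fin gc[OF s(1)] by simp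
  also have "coeff_mat M (g s) = block n A s 0" using M s(1) by (simp add: associated_def)
  also have "\<dots> = block n A r p"
  proof -
    have "g s \<otimes> inv (g 0) = g r \<otimes> inv (g p)" using s g0 gc rp by simp
    with A s(1) k0 rp show ?thesis unfolding block_circulant_def by blast
  qed
  also have "\<dots> $$ (i mod n, j mod n) = A $$ (i, j)" using n by (simp add: block_def r_def p_def)
  finally show "A $$ (i, j) = ?B $$ (i, j)" ..
qed

theorem proposition5:
  fixes G :: "('g, 'b) monoid_scheme"
    and g :: "nat \<Rightarrow> 'g"
    and n k :: nat
    and A :: "complex mat"
    and M :: "('g \<Rightarrow> complex) mat"
  assumes "group G"
    and "finite (carrier G)"
    and "Coset.order G = k"
    and "bij_betw g {..<k} (carrier G)"
    and "g 0 = \<one>\<^bsub>G\<^esub>"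
    and "block_circulant G k g n A"
    and "associated G k g n A M"
  shows "(\<exists>P. permutation_matrix (n * k) P \<and>
              inv\<^bsub>GL (n * k)\<^esub> P * A * P = fourier G n M k (regular_rep G k g))
       \<and> (\<forall>ps. complete_system G ps \<longrightarrow>
              eigenvalue_mset A =
                (\<Sum>(m, \<pi>)\<leftarrow>ps. repeat_mset m (eigenvalue_mset (fourier G n M m \<pi>))))"
proof -
  interpret group G by fact
  note fin = assms(2) and g = assms(4)
  have M: "M \<in> mat_group_algebra G n" using assms(7) by (simp add: associated_def)
  then have C: "coeff_mat M x \<in> carrier_mat n n" for x by (auto simp: coeff_mat_def mat_group_algebra_def)
  have A: "A \<in> carrier_mat (n * k) (n * k)" using assms(6) by (simp add: block_circulant_def)
  note bt = block_circulant_eq_block_transform[OF g assms(5-7) fin]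
  have rc: "regular_rep G k g x \<in> carrier_mat k k" for x by (simp add: regular_rep_def)
  have "\<exists>P. permutation_matrix (n * k) P \<and> inv\<^bsub>GL (n * k)\<^esub> P * A * P = fourier G n M k (regular_rep G k g)"
  proof -
    \<comment> \<open>Since A is the transform with exchanged factors, P is the permutation matrix
      that exchanges them back.\<close>
    have per: "transpose_index k n permutes {..<n * k}"
      using transpose_index_permutes[of k n] by (simp add: mult.commute)
    show ?thesis
      unfolding permutation_matrix_def fourier_similar(1)[OF fin M rc] bt[symmetric]
      using permutation_conjugate(1)[OF per A] per by blast
  qed
  moreover have "eigenvalue_mset A = (\<Sum>(m, \<pi>)\<leftarrow>ps. repeat_mset m (eigenvalue_mset (fourier G n M m \<pi>)))"
    if ps: "complete_system G ps" for ps
  proof -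
    define f where "f p = char_poly (block_transform n (coeff_mat M) (carrier G) (fst p) (snd p))" for p
    from irreducible_constituents[OF regular_representation[OF g] ps]
    obtain qs where qs: "set qs \<subseteq> set ps"
      and tr: "\<And>x. x \<in> carrier G \<Longrightarrow> mat_trace (regular_rep G k g x) = (\<Sum>(l, \<rho>)\<leftarrow>qs. mat_trace (\<rho> x))"
      and cp: "\<And>n C. (\<forall>x\<in>carrier G. C x \<in> carrier_mat n n) \<Longrightarrow>
           char_poly (block_transform n C (carrier G) k (regular_rep G k g))
             = (\<Prod>(l, \<rho>)\<leftarrow>qs. char_poly (block_transform n C (carrier G) l \<rho>))" by force
    have cnt: "count_list qs p = fst p" if "p \<in> set ps" for p
      using regular_multiplicity[OF fin g ps qs tr, of "fst p" "snd p"] that by simp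
    \<comment> \<open>The constituents qs were found without reference to M; its coefficients are
      inserted only here.\<close>
    have "char_poly A = (\<Prod>q\<leftarrow>qs. f q)"
      using cp[of "coeff_mat M" n] C bt by (simp add: f_def case_prod_unfold)
    also have "\<dots> = (\<Prod>p\<in>set ps. f p ^ count_list qs p)"
      by (rule prod_list_eq_prod_count) (use qs in auto)
    also have "\<dots> = (\<Prod>p\<in>set ps. f p ^ fst p)" by (rule prod.cong) (auto simp: cnt)
    finally have "char_poly A = (\<Prod>p\<in>set ps. f p ^ fst p)" .
    \<comment> \<open>Characteristic polynomials are monic, hence nonzero, as is required to turn
      the roots of a product into a sum of multisets.\<close>
    moreover have "f p ^ fst p \<noteq> 0" for p
    proof -
      have "block_transform n (coeff_mat M) (carrier G) (fst p) (snd p) \<in> carrier_mat (fst p * n) (fst p * n)"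
        by (simp add: block_transform_def)
      from degree_monic_char_poly[OF this] show ?thesis by (auto simp: f_def)
    qed
    ultimately have "eigenvalue_mset A = (\<Sum>p\<in>set ps. repeat_mset (fst p) (proots (f p)))"
      by (simp add: eigenvalue_mset_def proots_prod proots_power)
    also have "\<dots> = (\<Sum>p\<in>set ps. repeat_mset (fst p) (eigenvalue_mset (fourier G n M (fst p) (snd p))))"
    proof (rule sum.cong)
      fix p assume "p \<in> set ps"
      then have "representation G (fst p) (snd p)"
        using ps by (auto simp: complete_system_def irreducible_rep_def)
      from char_poly_similar[OF fourier_similar(2)[OF fin M representationD(1)[OF this]]]
      show "repeat_mset (fst p) (proots (f p)) = repeat_mset (fst p) (eigenvalue_mset (fourier G n M (fst p) (snd p)))"
        by (simp add: f_def eigenvalue_mset_def)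
    qed simp
    also have "\<dots> = (\<Sum>p\<leftarrow>ps. repeat_mset (fst p) (eigenvalue_mset (fourier G n M (fst p) (snd p))))"
      by (rule sum_list_distinct_conv_sum_set[symmetric]) (rule complete_system_distinct[OF is_group ps])
    finally show ?thesis by (simp add: case_prod_unfold)
  qed
  ultimately show ?thesis by blast
qed

end
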